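(* Let $\mathcal{H}_1,\mathcal{H}_2$ be separable Hilbert spaces, let $(\psi_k)_{k\in K}\subseteq\mathcal{H}_1$ and $(\phi_k)_{k\in K}\subseteq\mathcal{H}_2$ be Bessel sequences with bounds $B$ and $B'$ respectively, and let $\mathbf{M}=\mathbf{M}_{m,(\phi_k),(\psi_k)}$ be the Bessel multiplier with symbol $m=(m_k)_{k\in K}$, i.e. $\mathbf{M}f=\sum_k m_k\langle f,\psi_k\rangle\phi_k$. Then: 1. If $m\in l^\infty$, then $\mathbf{M}:\mathcal{H}_1\to\mathcal{H}_2$ is a well-defined bounded operator with $\|\mathbf{M}\|_{Op}\le\sqrt{B'}\sqrt{B}\,\|m\|_\infty$. Furthermore the sum $\sum_k m_k\langle f,\psi_k\rangle\phi_k$ converges unconditionally for all $f\in\mathcal{H}_1$. 2. $\left(\mathbf{M}_{m,(\phi_k),(\psi_k)}\right)^*=\mathbf{M}_{\overline{m},(\psi_k),(\phi_k)}$ (for $m\in l^\infty$). Therefore, if $m$ is real-valued and $(\phi_k)=(\psi_k)$, $\mathbf{M}$ is self-adjoint. 3. If $m\in c_0$, then $\mathbf{M}$ is a compact operator. 4. If $m\in l^1$, then $\mathbf{M}$ is a trace class operator with $\|\mathbf{M}\|_{trace}\le\sqrt{B'}\sqrt{B}\,\|m\|_1$, and (when $\mathcal{H}_1=\mathcal{H}_2$, so that the trace makes sense) $\mathrm{tr}(\mathbf{M})=\sum_k m_k\langle\phi_k,\psi_k\rangle$. 5. If $m\in l^2$, then $\mathbf{M}$ is a Hilbert–Schmidt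 operator with $\|\mathbf{M}\|_{\mathcal{HS}}\le\sqrt{B'}\sqrt{B}\,\|m\|_2$.
   Context: $K$ is a countable index set; $l^p=l^p(K)$, and $c_0=c_0(K)$ is the space of sequences tending to $0$. Inner products are linear in the first argument. A sequence $(\psi_k)_{k\in K}$ in a Hilbert space $\mathcal{H}$ is a Bessel sequence with bound $B>0$ if $\sum_k|\langle f,\psi_k\rangle|^2\le B\|f\|^2$ for all $f\in\mathcal{H}$. For Bessel sequences $(\psi_k)\subseteq\mathcal{H}_1$, $(\phi_k)\subseteq\mathcal{H}_2$ and $m\in l^\infty(K)$, the Bessel multiplier with symbol $m$ is $\mathbf{M}_{m,(\phi_k),(\psi_k)}:\mathcal{H}_1\to\mathcal{H}_2$, $f\mapsto\sum_k m_k\langle f,\psi_k\rangle\phi_k$ (the first listed sequence is used for synthesis, the second for analysis). $\|\cdot\|_{Op}$, $\|\cdot\|_{trace}$, $\|\cdot\|_{\mathcal{HS}}$ are the operator, trace class and Hilbert–Schmidt norms. *)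

theory Defs
  imports "HOL-Analysis.Analysis"
begin

section \<open>Complex Hilbert spaces\<close>

text \<open>
  A complex inner product space is presented together with its underlying real inner product
  space, whose inner product is the real part of the complex one. Positive definiteness and
  \<open>norm x = sqrt (Re (cinner x x))\<close> are thus inherited from the class \<open>real_inner\<close>.
  The complex inner product is linear in the first argument.
\<close>

class complex_inner = real_inner +
  fixes scaleC :: "complex \<Rightarrow> 'a \<Rightarrow> 'a"  (infixr \<open>*\<^sub>C\<close> 75)
    and cinner :: "'a \<Rightarrow> 'a \<Rightarrow> complex"
  assumes scaleC_add_right: "a *\<^sub>C (x + y) = a *\<^sub>C x + a *\<^sub>C y"
    and scaleC_add_left: "(a + b) *\<^sub>C x = a *\<^sub>C x + b *\<^sub>C x"
    and scaleC_scaleC: "a *\<^sub>C (b *\<^sub>C x) = (a * b) *\<^sub>C x"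
    and scaleC_one: "1 *\<^sub>C x = x"
    and scaleR_scaleC: "r *\<^sub>R x = complex_of_real r *\<^sub>C x"
    and cinner_commute: "cinner x y = cnj (cinner y x)"
    and cinner_add_left: "cinner (x + y) z = cinner x z + cinner y z"
    and cinner_scaleC_left: "cinner (a *\<^sub>C x) y = a * cinner x y"
    and inner_Re_cinner: "inner x y = Re (cinner x y)"

class complex_hilbert_space = complex_inner + complete_space

instantiation complex :: complex_hilbert_space
begin

definition scaleC_complex :: "complex \<Rightarrow> complex \<Rightarrow> complex"
  where "scaleC_complex a x = a * x"

definition cinner_complex :: "complex \<Rightarrow> complex \<Rightarrow> complex"
  where "cinner_complex x y = x * cnj y"

instance
  by standard
    (auto simp: scaleC_complex_def cinner_complex_def algebra_simps inner_complex_def scaleR_conv_of_real)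

end

definition is_onb :: "'a::complex_hilbert_space set \<Rightarrow> bool" where
  "is_onb E \<longleftrightarrow>
     (\<forall>e\<in>E. norm e = 1) \<and>
     (\<forall>e\<in>E. \<forall>e'\<in>E. e \<noteq> e' \<longrightarrow> cinner e e' = 0) \<and>
     (\<forall>x. (\<forall>e\<in>E. cinner x e = 0) \<longrightarrow> x = 0)"


section \<open>Operators\<close>

definition bounded_clinear :: "('a::complex_hilbert_space \<Rightarrow> 'b::complex_hilbert_space) \<Rightarrow> bool" where
  "bounded_clinear A \<longleftrightarrow> bounded_linear A \<and> (\<forall>c x. A (c *\<^sub>C x) = c *\<^sub>C A x)"

definition cadjoint ::
    "('a::complex_hilbert_space \<Rightarrow> 'b::complex_hilbert_space) \<Rightarrow> ('b \<Rightarrow> 'a)" where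
  "cadjoint A = (THE A'. \<forall>x y. cinner (A x) y = cinner x (A' y))"

definition self_adjoint_op :: "('a::complex_hilbert_space \<Rightarrow> 'a) \<Rightarrow> bool" where
  "self_adjoint_op A \<longleftrightarrow> bounded_clinear A \<and> cadjoint A = A"

definition compact_op :: "('a::complex_hilbert_space \<Rightarrow> 'b::complex_hilbert_space) \<Rightarrow> bool" where
  "compact_op A \<longleftrightarrow> bounded_clinear A \<and> compact (closure (A ` cball 0 1))"

definition positive_op :: "('a::complex_hilbert_space \<Rightarrow> 'a) \<Rightarrow> bool" where
  "positive_op P \<longleftrightarrow> bounded_clinear P \<and> (\<forall>x. cinner (P x) x \<in> \<real>\<^sub>\<ge>\<^sub>0)"

text \<open>The absolute value of \<open>A\<close>, i.e. the positive square root of \<open>A\<^sup>* A\<close>.\<close>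

definition abs_op ::
    "('a::complex_hilbert_space \<Rightarrow> 'b::complex_hilbert_space) \<Rightarrow> ('a \<Rightarrow> 'a)" where
  "abs_op A = (THE P. positive_op P \<and> P \<circ> P = cadjoint A \<circ> A)"

text \<open>
  The trace and the Hilbert--Schmidt norm are the values obtained from \<^emph>\<open>every\<close> orthonormal
  basis, so that equations about them include independence of the chosen basis.
\<close>

definition trace_op :: "('a::complex_hilbert_space \<Rightarrow> 'a) \<Rightarrow> complex" where
  "trace_op A = (THE t. \<forall>E. is_onb E \<longrightarrow> ((\<lambda>e. cinner (A e) e) has_sum t) E)"

definition trace_class :: "('a::complex_hilbert_space \<Rightarrow> 'b::complex_hilbert_space) \<Rightarrow> bool" where
  "trace_class A \<longleftrightarrow>
     bounded_clinear A \<and> (\<exists>E. is_onb E \<and> (\<lambda>e. cinner (abs_op A e) e) summable_on E)"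

definition trace_norm :: "('a::complex_hilbert_space \<Rightarrow> 'b::complex_hilbert_space) \<Rightarrow> real" where
  "trace_norm A = Re (trace_op (abs_op A))"

definition hilbert_schmidt ::
    "('a::complex_hilbert_space \<Rightarrow> 'b::complex_hilbert_space) \<Rightarrow> bool" where
  "hilbert_schmidt A \<longleftrightarrow>
     bounded_clinear A \<and> (\<exists>E. is_onb E \<and> (\<lambda>e. (norm (A e))\<^sup>2) summable_on E)"

definition hilbert_schmidt_norm ::
    "('a::complex_hilbert_space \<Rightarrow> 'b::complex_hilbert_space) \<Rightarrow> real" where
  "hilbert_schmidt_norm A =
     sqrt (THE s. \<forall>E. is_onb E \<longrightarrow> ((\<lambda>e. (norm (A e))\<^sup>2) has_sum s) E)"


section \<open>Sequence spaces over an index set\<close>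

definition linf :: "'k set \<Rightarrow> ('k \<Rightarrow> complex) set" where
  "linf K = {m. bounded (m ` K)}"

text \<open>The inserted \<open>0\<close> only matters for \<open>K = {}\<close>.\<close>

definition linf_norm :: "'k set \<Rightarrow> ('k \<Rightarrow> complex) \<Rightarrow> real" where
  "linf_norm K m = Sup (insert 0 ((\<lambda>k. norm (m k)) ` K))"

definition c0 :: "'k set \<Rightarrow> ('k \<Rightarrow> complex) set" where
  "c0 K = {m. \<forall>\<epsilon>>0. finite {k\<in>K. norm (m k) \<ge> \<epsilon>}}"

definition lp :: "real \<Rightarrow> 'k set \<Rightarrow> ('k \<Rightarrow> complex) set" where
  "lp p K = {m. (\<lambda>k. norm (m k) powr p) summable_on K}"

definition lp_norm :: "real \<Rightarrow> 'k set \<Rightarrow> ('k \<Rightarrow> complex) \<Rightarrow> real" where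
  "lp_norm p K m = (\<Sum>\<^sub>\<infinity>k\<in>K. norm (m k) powr p) powr (1 / p)"


section \<open>Bessel sequences and multipliers\<close>

definition bessel_seq :: "'k set \<Rightarrow> ('k \<Rightarrow> 'a::complex_hilbert_space) \<Rightarrow> real \<Rightarrow> bool" where
  "bessel_seq K \<psi> B \<longleftrightarrow> B > 0 \<and>
     (\<forall>f. (\<lambda>k. (norm (cinner f (\<psi> k)))\<^sup>2) summable_on K \<and>
          (\<Sum>\<^sub>\<infinity>k\<in>K. (norm (cinner f (\<psi> k)))\<^sup>2) \<le> B * (norm f)\<^sup>2)"

text \<open>
  As \<open>K\<close> carries no order, the sum is the unordered one (limit over the net of finite subsets
  of \<open>K\<close>); its existence, \<open>summable_on\<close>, is unconditional convergence.
\<close>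

definition bessel_multiplier ::
    "'k set \<Rightarrow> ('k \<Rightarrow> complex) \<Rightarrow> ('k \<Rightarrow> 'b::complex_hilbert_space) \<Rightarrow>
     ('k \<Rightarrow> 'a::complex_hilbert_space) \<Rightarrow> 'a \<Rightarrow> 'b" where
  "bessel_multiplier K m \<phi> \<psi> f = (\<Sum>\<^sub>\<infinity>k\<in>K. (m k * cinner f (\<psi> k)) *\<^sub>C \<phi> k)"

end

theory Submission
  imports Defs
begin

text \<open>
  Every bound comes from the estimate \<open>norm (\<Sum>k. c k *\<^sub>C \<phi> k) \<le> sqrt B * L2_set c\<close>, dual to the
  Bessel inequality. Compactness holds because finite sections of a null sequence approximate it
  uniformly. For an absolutely summable symbol, \<open>M\<^sup>* M\<close> has an orthonormal basis of eigenvectors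
  \<open>e\<close>, with eigenvalues \<open>(norm (M e))\<^sup>2\<close>; the absolute value of \<open>M\<close> is then itself the Bessel
  multiplier on that basis with symbol \<open>norm (M e)\<close>, so its trace is covered by the trace formula
  for multipliers, and no polar decomposition is needed.
\<close>

text \<open>Two obstacles shape the proof. The series behind a multiplier converge unconditionally
  but in general not absolutely, so summability must come from a Cauchy criterion on finite subsets
  and not from comparison of norms. And \<open>cadjoint\<close>, \<open>abs_op\<close>,
  \<open>trace_op\<close> and \<open>hilbert_schmidt_norm\<close> are definite descriptions: each
  needs a witness and a proof that no other value fits. The adjoint is written down explicitly, as
  the multiplier with conjugated symbol and exchanged sequences. For \<open>abs_op\<close>,
  uniqueness of the positive square root is decided on eigenvectors only, where its action is
  forced. Basis independence comes from exchanging sums: for the trace between the index set and the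
  basis, for the Hilbert-Schmidt norm between the two spaces, against one fixed basis of the
  codomain. The factor \<open>sqrt B' * sqrt B\<close> takes one root from each sequence, either
  through the norm of analysis and synthesis or through the bound on each single vector.\<close>

instance complex_hilbert_space \<subseteq> banach ..

section \<open>Complex inner products\<close>

lemma cinner_add_right: "cinner x (y + z) = cinner x y + cinner (x :: 'a::complex_inner) z"
  by (metis cinner_add_left cinner_commute complex_cnj_add)

lemma cinner_scaleC_right: "cinner x (a *\<^sub>C y) = cnj a * cinner (x :: 'a::complex_inner) y"
  by (metis cinner_commute cinner_scaleC_left complex_cnj_mult)

lemma scaleC_scaleR_commute: "a *\<^sub>C (r *\<^sub>R x) = r *\<^sub>R (a *\<^sub>C (x :: 'a::complex_inner))"
  by (simp add: scaleR_scaleC scaleC_scaleC mult.commute)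

lemma scaleC_zero_left [simp]: "0 *\<^sub>C (x :: 'a::complex_inner) = 0"
  using scaleC_add_left[of 0 0 x] by simp

lemma cinner_self: "cinner x x = complex_of_real ((norm (x :: 'a::complex_inner))\<^sup>2)"
proof -
  have "Im (cinner x x) = 0"
    using arg_cong[OF cinner_commute[of x x], of Im] by simp
  then show ?thesis
    by (simp add: complex_eq_iff power2_norm_eq_inner inner_Re_cinner)
qed

lemma norm_cinner_self: "norm (cinner x x) = norm (x :: 'a::complex_inner) * norm x"
  by (simp add: cinner_self norm_mult power2_eq_square)

lemma norm_scaleC [simp]: "norm (a *\<^sub>C (x :: 'a::complex_inner)) = norm a * norm x"
proof -
  have "complex_of_real ((norm (a *\<^sub>C x))\<^sup>2) = (a * cnj a) * complex_of_real ((norm x)\<^sup>2)"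
    unfolding cinner_self[symmetric] cinner_scaleC_left cinner_scaleC_right by simp
  also have "\<dots> = complex_of_real ((norm a * norm x)\<^sup>2)"
    unfolding complex_norm_square[symmetric] of_real_mult[symmetric] power_mult_distrib ..
  finally have "(norm (a *\<^sub>C x))\<^sup>2 = (norm a * norm x)\<^sup>2"
    using of_real_eq_iff by blast
  then show ?thesis
    by (simp add: power2_eq_iff_nonneg)
qed

lemma norm_cinner_commute: "norm (cinner x y) = norm (cinner (y :: 'a::complex_inner) x)"
  by (metis cinner_commute complex_mod_cnj)

lemma norm_cinner_le: "norm (cinner x y) \<le> norm x * norm (y :: 'a::complex_inner)"
proof -
  \<comment> \<open>A phase of modulus at most 1 (it is 0 if the inner product vanishes) that turns
    the inner product into its modulus, so the real Cauchy-Schwarz inequality applies.\<close>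
  define a where "a = cnj (sgn (cinner x y))"
  have "cinner (a *\<^sub>C x) y = of_real (norm (cinner x y))"
    unfolding cinner_scaleC_left a_def
    using complex_norm_square[of "cinner x y"]
    by (cases "cinner x y = 0") (auto simp: sgn_eq power2_eq_square field_simps)
  then have "norm (cinner x y) = inner (a *\<^sub>C x) y"
    by (simp add: inner_Re_cinner)
  also have "\<dots> \<le> norm (a *\<^sub>C x) * norm y"
    by (rule norm_cauchy_schwarz)
  also have "\<dots> \<le> 1 * norm x * norm y"
    by (auto simp: a_def norm_sgn intro!: mult_right_mono)
  finally show ?thesis by simp
qed

lemma bounded_linear_cinner_left: "bounded_linear (\<lambda>x :: 'a::complex_inner. cinner x y)"
proof
  show "cinner (r *\<^sub>R x) y = r *\<^sub>R cinner x y" for r and x :: 'a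
    by (simp add: scaleR_scaleC cinner_scaleC_left scaleC_complex_def)
qed (auto simp: cinner_add_left intro!: exI[of _ "norm y"] norm_cinner_le)

lemma bounded_linear_cinner_right: "bounded_linear (\<lambda>y :: 'a::complex_inner. cinner x y)"
proof
  show "cinner x (r *\<^sub>R y) = r *\<^sub>R cinner x y" for r and y :: 'a
    by (simp add: scaleR_scaleC cinner_scaleC_right scaleC_complex_def)
  show "\<exists>K. \<forall>y. norm (cinner x y) \<le> norm y * K"
    by (rule exI[of _ "norm x"]) (metis norm_cinner_le mult.commute)
qed (auto simp: cinner_add_right)

lemma bounded_linear_scaleC_right: "bounded_linear (\<lambda>x :: 'a::complex_inner. a *\<^sub>C x)"
  by standard (auto simp: scaleC_add_right scaleC_scaleR_commute intro!: exI[of _ "norm a"])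

lemma bounded_linear_scaleC_left: "bounded_linear (\<lambda>a. a *\<^sub>C (x :: 'a::complex_inner))"
  by standard (auto simp: scaleC_add_left scaleR_scaleC scaleC_scaleC scaleC_complex_def intro!: exI[of _ "norm x"])

lemmas cinner_diff_left = linear_diff[OF bounded_linear.linear[OF bounded_linear_cinner_left]]
lemmas cinner_sum_left = linear_sum[OF bounded_linear.linear[OF bounded_linear_cinner_left]]
lemmas cinner_zero_left [simp] = linear_0[OF bounded_linear.linear[OF bounded_linear_cinner_left]]
lemmas cinner_diff_right = linear_diff[OF bounded_linear.linear[OF bounded_linear_cinner_right]]
lemmas cinner_sum_right = linear_sum[OF bounded_linear.linear[OF bounded_linear_cinner_right]]
lemmas cinner_zero_right [simp] = linear_0[OF bounded_linear.linear[OF bounded_linear_cinner_right]]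
lemmas scaleC_zero_right [simp] = linear_0[OF bounded_linear.linear[OF bounded_linear_scaleC_right]]

lemma cinner_ext_right:
  assumes "\<And>z. cinner z x = cinner z (y :: 'a::complex_inner)"
  shows "x = y"
  using assms[of "x - y"] cinner_self[of "x - y"] by (simp add: cinner_diff_right)

text \<open>Nondegeneracy of the inner product settles the definite description as soon as some
  candidate is at hand, so no representation theorem enters.\<close>

lemma cadjoint_eqI:
  assumes "\<And>x y. cinner (A x) y = cinner x (A' y)"
  shows "cadjoint A = A'"
  unfolding cadjoint_def
proof (rule the_equality)
  show "\<forall>x y. cinner (A x) y = cinner x (A' y)"
    using assms by blast
  show "C = A'" if "\<forall>x y. cinner (A x) y = cinner x (C y)" for C
    using that assms by (metis cinner_ext_right ext)
qed

section \<open>Square-summable families and Bessel sequences\<close>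

text \<open>Two finite sets that both contain \<open>F0\<close> have sums differing only by two
  pieces outside \<open>F0\<close>, each below \<open>e / 2\<close>. The net of partial sums is
  therefore Cauchy, and completeness gives the limit without absolute convergence.\<close>

lemma summable_on_Cauchy_criterion:
  fixes f :: "'k \<Rightarrow> 'a::banach"
  assumes small: "\<And>e. e > 0 \<Longrightarrow>
    \<exists>F0. finite F0 \<and> F0 \<subseteq> A \<and> (\<forall>F. finite F \<and> F \<subseteq> A - F0 \<longrightarrow> norm (sum f F) < e)"
  shows "f summable_on A"
proof -
  have "\<exists>P. eventually P (finite_subsets_at_top A) \<and>
          (\<forall>F F'. P F \<and> P F' \<longrightarrow> dist (sum f F) (sum f F') < e)" if "e > 0" for e
  proof -
    have "e / 2 > 0"
      using that by simp
    then obtain F0 where F0: "finite F0" "F0 \<subseteq> A"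
        "\<And>F. finite F \<Longrightarrow> F \<subseteq> A - F0 \<Longrightarrow> norm (sum f F) < e / 2"
      using small by metis
    define P where "P F \<longleftrightarrow> finite F \<and> F0 \<subseteq> F \<and> F \<subseteq> A" for F
    have "eventually P (finite_subsets_at_top A)"
      unfolding eventually_finite_subsets_at_top P_def using F0 by blast
    moreover have "dist (sum f F) (sum f F') < e" if "P F" "P F'" for F F'
    proof -
      have eq: "sum f G = sum f F0 + sum f (G - F0)" if "P G" for G
        using that F0(1) unfolding P_def by (metis add.commute sum.subset_diff)
      have lt: "norm (sum f (G - F0)) < e / 2" if "P G" for G
        using that F0 unfolding P_def by blast
      have "dist (sum f F) (sum f F') = norm (sum f (F - F0) - sum f (F' - F0))"
        by (simp add: dist_norm eq[OF that(1)] eq[OF that(2)])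
      also have "\<dots> \<le> norm (sum f (F - F0)) + norm (sum f (F' - F0))"
        by (rule norm_triangle_ineq4)
      also have "\<dots> < e"
        using lt[OF that(1)] lt[OF that(2)] by simp
      finally show ?thesis .
    qed
    ultimately show ?thesis by blast
  qed
  then have "cauchy_filter (filtermap (sum f) (finite_subsets_at_top A))"
    by (simp add: cauchy_filter_metric_filtermap)
  then obtain L where "(sum f \<longlongrightarrow> L) (finite_subsets_at_top A)"
    using complete_uniform[where S = "UNIV :: 'a set"] complete_UNIV_cuspace by (force simp add: filterlim_def)
  then show ?thesis
    using summable_on_def has_sum_def by blast
qed

lemma nonneg_summable_small_tails:
  fixes g :: "'k \<Rightarrow> real"
  assumes "g summable_on A" and "\<And>k. k \<in> A \<Longrightarrow> g k \<ge> 0" and "e > 0"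
  obtains F0 where "finite F0" "F0 \<subseteq> A" "\<And>F. finite F \<Longrightarrow> F \<subseteq> A - F0 \<Longrightarrow> sum g F < e"
proof -
  obtain F0 where F0: "finite F0" "F0 \<subseteq> A" "dist (sum g F0) (infsum g A) \<le> e / 2"
    using infsum_finite_approximation[OF assms(1), of "e / 2"] assms(3) by auto
  show ?thesis
  proof (rule that[OF F0(1,2)])
    fix F assume F: "finite F" "F \<subseteq> A - F0"
    have "sum g (F \<union> F0) = sum g F + sum g F0"
      using F F0 by (intro sum.union_disjoint) auto
    moreover have "sum g (F \<union> F0) \<le> infsum g A"
      using F F0 assms by (intro finite_sum_le_infsum) auto
    ultimately show "sum g F < e"
      using F0(3) assms(3) unfolding dist_real_def by linarith
  qed
qed

lemma bessel_seq_L2_set_le: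
  assumes "bessel_seq K \<psi> B" "finite F" "F \<subseteq> K"
  shows "L2_set (\<lambda>k. norm (cinner f (\<psi> k))) F \<le> sqrt B * norm f"
proof -
  have "(\<Sum>k\<in>F. (norm (cinner f (\<psi> k)))\<^sup>2) \<le> (\<Sum>\<^sub>\<infinity>k\<in>K. (norm (cinner f (\<psi> k)))\<^sup>2)"
    using assms by (intro finite_sum_le_infsum) (auto simp: bessel_seq_def)
  also have "\<dots> \<le> B * (norm f)\<^sup>2"
    using assms(1) by (auto simp: bessel_seq_def)
  finally have "L2_set (\<lambda>k. norm (cinner f (\<psi> k))) F \<le> sqrt (B * (norm f)\<^sup>2)"
    unfolding L2_set_def by (rule real_sqrt_le_mono)
  then show ?thesis
    by (simp add: real_sqrt_mult)
qed

text \<open>Test the Bessel inequality on \<psi> k itself, keep only the term at \<open>k\<close>,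
  and cancel one factor of the norm.\<close>

lemma bessel_seq_norm_le:
  assumes "bessel_seq K \<psi> B" "k \<in> K"
  shows "norm (\<psi> k) \<le> sqrt B"
proof -
  have "norm (cinner (\<psi> k) (\<psi> k)) \<le> sqrt B * norm (\<psi> k)"
    using bessel_seq_L2_set_le[OF assms(1), of "{k}" "\<psi> k"] assms(2) by simp
  then have "norm (\<psi> k) * norm (\<psi> k) \<le> sqrt B * norm (\<psi> k)"
    by (simp add: norm_cinner_self)
  moreover have "0 \<le> sqrt B"
    using assms(1) by (simp add: bessel_seq_def)
  ultimately show ?thesis
    by (cases "\<psi> k = 0") auto
qed

text \<open>Duality: pair the sum \<open>g\<close> with itself, apply Cauchy-Schwarz to the
  coefficients and the analysis of \<open>g\<close>, and cancel one factor
  \<open>norm g\<close>.\<close>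

lemma bessel_seq_norm_sum_le:
  assumes "bessel_seq K \<phi> B" "finite F" "F \<subseteq> K"
  shows "norm (\<Sum>k\<in>F. c k *\<^sub>C \<phi> k) \<le> sqrt B * L2_set (\<lambda>k. norm (c k)) F"
proof -
  define g where "g = (\<Sum>k\<in>F. c k *\<^sub>C \<phi> k)"
  have "cinner g g = (\<Sum>k\<in>F. c k * cinner (\<phi> k) g)"
    by (subst g_def) (simp add: cinner_sum_left cinner_scaleC_left)
  then have "norm (cinner g g) \<le> (\<Sum>k\<in>F. \<bar>norm (c k)\<bar> * \<bar>norm (cinner g (\<phi> k))\<bar>)"
    by (metis (no_types, lifting) norm_sum sum.cong norm_mult norm_cinner_commute abs_norm_cancel)
  also have "\<dots> \<le> L2_set (\<lambda>k. norm (c k)) F * L2_set (\<lambda>k. norm (cinner g (\<phi> k))) F"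
    by (rule L2_set_mult_ineq)
  also have "\<dots> \<le> L2_set (\<lambda>k. norm (c k)) F * (sqrt B * norm g)"
    by (intro mult_left_mono bessel_seq_L2_set_le[OF assms]) auto
  finally have "norm g * norm g \<le> sqrt B * L2_set (\<lambda>k. norm (c k)) F * norm g"
    by (simp add: norm_cinner_self mult_ac)
  moreover have "0 \<le> sqrt B"
    using assms(1) by (simp add: bessel_seq_def)
  ultimately have "norm g \<le> sqrt B * L2_set (\<lambda>k. norm (c k)) F"
    by (cases "g = 0") auto
  then show ?thesis
    by (simp add: g_def)
qed

lemma bessel_synthesis_summable:
  assumes "bessel_seq K \<phi> B" "(\<lambda>k. (norm (c k))\<^sup>2) summable_on K"
  shows "(\<lambda>k. c k *\<^sub>C \<phi> k) summable_on K"
proof (rule summable_on_Cauchy_criterion)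
  fix e :: real assume "e > 0"
  have B: "B > 0"
    using assms(1) by (simp add: bessel_seq_def)
  \<comment> \<open>The tail size is chosen so that \<open>sqrt (B * tail)\<close> falls below
    \<open>e\<close>.\<close>
  have "e\<^sup>2 / B > 0"
    using B \<open>e > 0\<close> by simp
  then obtain F0 where F0: "finite F0" "F0 \<subseteq> K"
      "\<And>F. finite F \<Longrightarrow> F \<subseteq> K - F0 \<Longrightarrow> (\<Sum>k\<in>F. (norm (c k))\<^sup>2) < e\<^sup>2 / B"
    using nonneg_summable_small_tails[OF assms(2)] by (metis zero_le_power2)
  have "norm (\<Sum>k\<in>F. c k *\<^sub>C \<phi> k) < e" if F: "finite F" "F \<subseteq> K - F0" for F
  proof -
    have "norm (\<Sum>k\<in>F. c k *\<^sub>C \<phi> k) \<le> sqrt B * L2_set (\<lambda>k. norm (c k)) F"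
      using F by (intro bessel_seq_norm_sum_le[OF assms(1)]) auto
    also have "\<dots> = sqrt (B * (\<Sum>k\<in>F. (norm (c k))\<^sup>2))"
      by (simp add: L2_set_def real_sqrt_mult)
    also have "\<dots> < sqrt (e\<^sup>2)"
      using F0(3)[OF F] B by (intro real_sqrt_less_mono) (simp add: field_simps)
    finally show ?thesis
      using \<open>e > 0\<close> by simp
  qed
  then show "\<exists>F0. finite F0 \<and> F0 \<subseteq> K \<and>
      (\<forall>F. finite F \<and> F \<subseteq> K - F0 \<longrightarrow> norm (\<Sum>k\<in>F. c k *\<^sub>C \<phi> k) < e)"
    using F0 by blast
qed

lemma has_sum_norm_le:
  fixes f :: "'k \<Rightarrow> 'a::real_normed_vector"
  assumes "(f has_sum S) A" "\<And>F. finite F \<Longrightarrow> F \<subseteq> A \<Longrightarrow> norm (sum f F) \<le> C"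
  shows "norm S \<le> C"
proof (rule tendsto_upperbound)
  show "((\<lambda>F. norm (sum f F)) \<longlongrightarrow> norm S) (finite_subsets_at_top A)"
    using assms(1) unfolding has_sum_def by (rule tendsto_norm)
  show "\<forall>\<^sub>F F in finite_subsets_at_top A. norm (sum f F) \<le> C"
    using assms(2) by (intro eventually_finite_subsets_at_top_weakI) auto
qed simp

lemma bessel_synthesis_norm_le:
  assumes "bessel_seq K \<phi> B" "(\<lambda>k. (norm (c k))\<^sup>2) summable_on K"
  shows "norm (\<Sum>\<^sub>\<infinity>k\<in>K. c k *\<^sub>C \<phi> k) \<le> sqrt (B * (\<Sum>\<^sub>\<infinity>k\<in>K. (norm (c k))\<^sup>2))"
proof (rule has_sum_norm_le)
  show "((\<lambda>k. c k *\<^sub>C \<phi> k) has_sum (\<Sum>\<^sub>\<infinity>k\<in>K. c k *\<^sub>C \<phi> k)) K"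
    using bessel_synthesis_summable[OF assms] by simp
  fix F assume F: "finite F" "F \<subseteq> K"
  have B: "B > 0"
    using assms(1) by (simp add: bessel_seq_def)
  have "norm (\<Sum>k\<in>F. c k *\<^sub>C \<phi> k) \<le> sqrt B * L2_set (\<lambda>k. norm (c k)) F"
    by (rule bessel_seq_norm_sum_le[OF assms(1) F])
  also have "\<dots> = sqrt (B * (\<Sum>k\<in>F. (norm (c k))\<^sup>2))"
    by (simp add: L2_set_def real_sqrt_mult)
  also have "\<dots> \<le> sqrt (B * (\<Sum>\<^sub>\<infinity>k\<in>K. (norm (c k))\<^sup>2))"
    using B F assms by (intro real_sqrt_le_mono mult_left_mono finite_sum_le_infsum) auto
  finally show "norm (\<Sum>k\<in>F. c k *\<^sub>C \<phi> k) \<le> sqrt (B * (\<Sum>\<^sub>\<infinity>k\<in>K. (norm (c k))\<^sup>2))" .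
qed

section \<open>Bounded symbols\<close>

lemma linf_bdd_above:
  assumes "m \<in> linf K"
  shows "bdd_above (insert 0 ((\<lambda>k. norm (m k)) ` K))"
  using assms unfolding bdd_above_insert by (auto simp: linf_def bounded_iff bdd_above_def)

lemma norm_le_linf_norm:
  assumes "m \<in> linf K" "k \<in> K"
  shows "norm (m k) \<le> linf_norm K m"
  unfolding linf_norm_def using assms by (intro cSup_upper linf_bdd_above) auto

lemma linfI:
  assumes "\<And>k. k \<in> K \<Longrightarrow> norm (m k) \<le> C"
  shows "m \<in> linf K"
  using assms by (auto simp: linf_def bounded_iff)

lemma multiplier_coeff_summable:
  assumes "bessel_seq K \<psi> B" "\<And>k. k \<in> K \<Longrightarrow> norm (m k) \<le> C"
  shows "(\<lambda>k. (norm (m k * cinner f (\<psi> k)))\<^sup>2) summable_on K" (is "?g summable_on K")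
    and "(\<Sum>\<^sub>\<infinity>k\<in>K. (norm (m k * cinner f (\<psi> k)))\<^sup>2) \<le> C\<^sup>2 * (B * (norm f)\<^sup>2)"
proof -
  have s: "(\<lambda>k. C\<^sup>2 * (norm (cinner f (\<psi> k)))\<^sup>2) summable_on K"
    using assms(1) by (intro summable_on_cmult_right) (auto simp: bessel_seq_def)
  have le: "?g k \<le> C\<^sup>2 * (norm (cinner f (\<psi> k)))\<^sup>2" if "k \<in> K" for k
    using assms(2)[OF that] by (auto simp: norm_mult power_mult_distrib intro!: mult_right_mono power_mono)
  show "?g summable_on K"
    using s le by (rule summable_on_comparison_test) auto
  then have "infsum ?g K \<le> (\<Sum>\<^sub>\<infinity>k\<in>K. C\<^sup>2 * (norm (cinner f (\<psi> k)))\<^sup>2)"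
    using s le by (rule infsum_mono)
  also have "\<dots> = C\<^sup>2 * (\<Sum>\<^sub>\<infinity>k\<in>K. (norm (cinner f (\<psi> k)))\<^sup>2)"
    by (rule infsum_cmult_right')
  also have "\<dots> \<le> C\<^sup>2 * (B * (norm f)\<^sup>2)"
    using assms(1) by (intro mult_left_mono) (auto simp: bessel_seq_def)
  finally show "infsum ?g K \<le> C\<^sup>2 * (B * (norm f)\<^sup>2)" .
qed

lemma bessel_multiplier_has_sum:
  assumes "bessel_seq K \<psi> B" "bessel_seq K \<phi> B'" "m \<in> linf K"
  shows "((\<lambda>k. (m k * cinner f (\<psi> k)) *\<^sub>C \<phi> k) has_sum bessel_multiplier K m \<phi> \<psi> f) K"
  unfolding bessel_multiplier_def
  using bessel_synthesis_summable[OF assms(2) multiplier_coeff_summable(1)[OF assms(1) norm_le_linf_norm[OF assms(3)]]]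
  by simp

text \<open>The bound \<open>C\<close> is left free because it is used with the supremum of the
  symbol for boundedness and with a small \<delta> for the tail of a null sequence.\<close>

lemma bessel_multiplier_norm_le:
  assumes "bessel_seq K \<psi> B" "bessel_seq K \<phi> B'" "\<And>k. k \<in> K \<Longrightarrow> norm (m k) \<le> C" "C \<ge> 0"
  shows "norm (bessel_multiplier K m \<phi> \<psi> f) \<le> sqrt B' * sqrt B * C * norm f"
proof -
  have B': "B' > 0"
    using assms(2) by (simp add: bessel_seq_def)
  have "norm (bessel_multiplier K m \<phi> \<psi> f) \<le> sqrt (B' * (\<Sum>\<^sub>\<infinity>k\<in>K. (norm (m k * cinner f (\<psi> k)))\<^sup>2))"
    unfolding bessel_multiplier_def
    by (intro bessel_synthesis_norm_le assms multiplier_coeff_summable(1)[OF assms(1,3)])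
  also have "\<dots> \<le> sqrt (B' * (C\<^sup>2 * (B * (norm f)\<^sup>2)))"
    using B' by (intro real_sqrt_le_mono mult_left_mono multiplier_coeff_summable(2)[OF assms(1,3)]) auto
  also have "\<dots> = sqrt B' * sqrt B * C * norm f"
    using assms(4) by (simp add: real_sqrt_mult)
  finally show ?thesis .
qed

lemma bounded_clinear_bessel_multiplier:
  assumes "bessel_seq K \<psi> B" "bessel_seq K \<phi> B'" "m \<in> linf K"
  shows "bounded_clinear (bessel_multiplier K m \<phi> \<psi>)" (is "bounded_clinear ?M")
proof -
  note hs = bessel_multiplier_has_sum[OF assms]
  have add: "?M (x + y) = ?M x + ?M y" for x y
    by (rule has_sum_unique[OF hs])
       (use has_sum_add[OF hs[of x] hs[of y]] in
         \<open>simp add: cinner_add_left ring_distribs scaleC_add_left\<close>)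
  have scale: "?M (c *\<^sub>C x) = c *\<^sub>C ?M x" for c x
    by (rule has_sum_unique[OF hs])
       (use has_sum_bounded_linear[OF bounded_linear_scaleC_right hs[of x], of c] in
         \<open>simp add: cinner_scaleC_left scaleC_scaleC mult_ac\<close>)
  have "norm (m k) \<le> max 0 (linf_norm K m)" if "k \<in> K" for k
    using norm_le_linf_norm[OF assms(3) that] by simp
  note le = bessel_multiplier_norm_le[OF assms(1,2) this]
  have "bounded_linear ?M"
    by (rule bounded_linear_intro[where K = "sqrt B' * sqrt B * max 0 (linf_norm K m)"])
       (use le in \<open>auto simp: add scale scaleR_scaleC mult_ac\<close>)
  then show ?thesis
    by (simp add: bounded_clinear_def scale)
qed

lemma linf_norm_nonneg:
  assumes "m \<in> linf K"
  shows "linf_norm K m \<ge> 0"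
  unfolding linf_norm_def using assms by (intro cSup_upper linf_bdd_above) auto

lemma onorm_bessel_multiplier_le:
  assumes "bessel_seq K \<psi> B" "bessel_seq K \<phi> B'" "m \<in> linf K"
  shows "onorm (bessel_multiplier K m \<phi> \<psi>) \<le> sqrt B' * sqrt B * linf_norm K m"
proof (rule onorm_bound)
  show "0 \<le> sqrt B' * sqrt B * linf_norm K m"
    using assms by (auto simp: bessel_seq_def linf_norm_nonneg)
qed (rule bessel_multiplier_norm_le[OF assms(1,2) norm_le_linf_norm[OF assms(3)] linf_norm_nonneg[OF assms(3)]])

lemma bessel_multiplier_cong:
  assumes "\<And>k. k \<in> K \<Longrightarrow> m k = m' k"
  shows "bessel_multiplier K m \<phi> \<psi> = bessel_multiplier K m' \<phi> \<psi>"
  unfolding bessel_multiplier_def using assms by (intro ext infsum_cong) auto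

lemma linf_cnj: "m \<in> linf K \<Longrightarrow> (\<lambda>k. cnj (m k)) \<in> linf K"
  by (auto simp: linf_def bounded_iff)

text \<open>Continuity moves the inner product inside the series. This scalar expansion is the
  common source of the adjoint, of the positivity of diagonal operators, of the trace formula and of
  the trace norm bound.\<close>

lemma cinner_bessel_multiplier_has_sum:
  assumes "bessel_seq K \<psi> B" "bessel_seq K \<phi> B'" "m \<in> linf K"
  shows "((\<lambda>k. m k * cinner x (\<psi> k) * cinner (\<phi> k) y) has_sum cinner (bessel_multiplier K m \<phi> \<psi> x) y) K"
  using has_sum_bounded_linear[OF bounded_linear_cinner_left bessel_multiplier_has_sum[OF assms]]
  by (simp add: cinner_scaleC_left)

lemma cinner_bessel_multiplier:
  assumes "bessel_seq K \<psi> B" "bessel_seq K \<phi> B'" "m \<in> linf K"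
  shows "cinner (bessel_multiplier K m \<phi> \<psi> x) y = cinner x (bessel_multiplier K (\<lambda>k. cnj (m k)) \<psi> \<phi> y)"
proof (rule has_sum_unique[OF cinner_bessel_multiplier_has_sum[OF assms]])
  have "((\<lambda>k. cinner x ((cnj (m k) * cinner y (\<phi> k)) *\<^sub>C \<psi> k)) has_sum
          cinner x (bessel_multiplier K (\<lambda>k. cnj (m k)) \<psi> \<phi> y)) K"
    by (intro has_sum_bounded_linear[OF bounded_linear_cinner_right]
          bessel_multiplier_has_sum[OF assms(2,1) linf_cnj] assms)
  moreover have "cinner x ((cnj (m k) * cinner y (\<phi> k)) *\<^sub>C \<psi> k) = m k * cinner x (\<psi> k) * cinner (\<phi> k) y" for k
    by (simp add: cinner_scaleC_right mult_ac cinner_commute[of "\<phi> k" y])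
  ultimately show "((\<lambda>k. m k * cinner x (\<psi> k) * cinner (\<phi> k) y) has_sum
          cinner x (bessel_multiplier K (\<lambda>k. cnj (m k)) \<psi> \<phi> y)) K"
    by simp
qed

lemma cadjoint_bessel_multiplier:
  assumes "bessel_seq K \<psi> B" "bessel_seq K \<phi> B'" "m \<in> linf K"
  shows "cadjoint (bessel_multiplier K m \<phi> \<psi>) = bessel_multiplier K (\<lambda>k. cnj (m k)) \<psi> \<phi>"
  by (rule cadjoint_eqI) (rule cinner_bessel_multiplier[OF assms])

lemma self_adjoint_bessel_multiplier:
  assumes "bessel_seq K \<psi> B" "m \<in> linf K" "\<And>k. k \<in> K \<Longrightarrow> m k \<in> \<real>"
  shows "self_adjoint_op (bessel_multiplier K m \<psi> \<psi>)"
proof -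
  have "bessel_multiplier K (\<lambda>k. cnj (m k)) \<psi> \<psi> = bessel_multiplier K m \<psi> \<psi>"
    by (rule bessel_multiplier_cong) (use assms(3) in \<open>auto simp: Reals_cnj_iff\<close>)
  then show ?thesis
    unfolding self_adjoint_op_def
    using bounded_clinear_bessel_multiplier[OF assms(1,1,2)] cadjoint_bessel_multiplier[OF assms(1,1,2)] by simp
qed

section \<open>Symbols vanishing at infinity\<close>

lemma c0_subset_linf:
  assumes "m \<in> c0 K"
  shows "m \<in> linf K"
proof -
  let ?F = "{k\<in>K. norm (m k) \<ge> 1}"
  have fin: "finite ?F"
    using assms by (auto simp: c0_def)
  have "norm (m k) \<le> Max (insert 1 ((\<lambda>k. norm (m k)) ` ?F))" if "k \<in> K" for k
  proof (cases "norm (m k) \<ge> 1")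
    case True
    then show ?thesis
      using fin that by (intro Max_ge) auto
  next
    case False
    moreover have "1 \<le> Max (insert 1 ((\<lambda>k. norm (m k)) ` ?F))"
      using fin by (intro Max_ge) auto
    ultimately show ?thesis by linarith
  qed
  then show ?thesis
    by (rule linfI)
qed

text \<open>A single index outside \<open>F0\<close> is already a tail, so the tail bound holds for
  its term alone and large entries are confined to \<open>F0\<close>.\<close>

lemma lp_subset_c0:
  assumes "m \<in> lp p K" "p > 0"
  shows "m \<in> c0 K"
  unfolding c0_def
proof (intro CollectI allI impI)
  fix \<epsilon> :: real assume "\<epsilon> > 0"
  then have pos: "\<epsilon> powr p > 0"
    by simp
  obtain F0 where F0: "finite F0"
      "\<And>F. finite F \<Longrightarrow> F \<subseteq> K - F0 \<Longrightarrow> (\<Sum>k\<in>F. norm (m k) powr p) < \<epsilon> powr p"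
    using nonneg_summable_small_tails[of "\<lambda>k. norm (m k) powr p", OF _ _ pos] assms(1)
    unfolding lp_def by (metis (mono_tags, lifting) mem_Collect_eq powr_ge_zero)
  have "{k\<in>K. norm (m k) \<ge> \<epsilon>} \<subseteq> F0"
  proof (intro subsetI, rule ccontr)
    fix k assume k: "k \<in> {k\<in>K. norm (m k) \<ge> \<epsilon>}" "k \<notin> F0"
    have "norm (m k) powr p < \<epsilon> powr p"
      using F0(2)[of "{k}"] k by simp
    moreover have "\<epsilon> powr p \<le> norm (m k) powr p"
      using k \<open>\<epsilon> > 0\<close> assms(2) by (intro powr_mono2) auto
    ultimately show False by simp
  qed
  then show "finite {k\<in>K. norm (m k) \<ge> \<epsilon>}"
    using F0(1) finite_subset by blast
qed

text \<open>A Minkowski sum of continuous images of a closed disc is compact. It will contain the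
  image of the unit ball under a finite section of a multiplier.\<close>

lemma compact_superset_combinations:
  fixes \<phi> :: "'k \<Rightarrow> 'a::complex_hilbert_space"
  assumes "finite F"
  shows "\<exists>C. compact C \<and> (\<forall>c. (\<forall>k\<in>F. norm (c k) \<le> R) \<longrightarrow> (\<Sum>k\<in>F. c k *\<^sub>C \<phi> k) \<in> C)"
  using assms
proof (induction F)
  case empty
  show ?case
    by (rule exI[of _ "{0}"]) auto
next
  case (insert j F)
  then obtain C where C: "compact C" "\<And>c. (\<forall>k\<in>F. norm (c k) \<le> R) \<Longrightarrow> (\<Sum>k\<in>F. c k *\<^sub>C \<phi> k) \<in> C"
    by blast
  have "compact ((\<lambda>a. a *\<^sub>C \<phi> j) ` cball 0 R)"
    by (intro compact_continuous_image linear_continuous_on bounded_linear_scaleC_left compact_cball)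
  from compact_sums[OF this C(1)] show ?case
    using insert.hyps C(2) by (intro exI conjI) (assumption, fastforce)
qed

text \<open>Total boundedness with the error split in thirds: one for a finite net of the finite
  section, one for the tail operator, and one as slack for the closure.\<close>

lemma compact_op_bessel_multiplier:
  assumes bessel: "bessel_seq K \<psi> B" "bessel_seq K \<phi> B'" and m: "m \<in> c0 K"
  shows "compact_op (bessel_multiplier K m \<phi> \<psi>)" (is "compact_op ?M")
proof -
  note linf = c0_subset_linf[OF m]
  have B: "B > 0" "B' > 0"
    using bessel by (auto simp: bessel_seq_def)
  have approx: "\<exists>S. finite S \<and> closure (?M ` cball 0 1) \<subseteq> (\<Union>x\<in>S. ball x e)" if "e > 0" for e
  proof -
    \<comment> \<open>Cutting the symbol at this height gives the tail multiplier norm at most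
      \<open>e / 3\<close>.\<close>
    define \<delta> where "\<delta> = e / (3 * (sqrt B' * sqrt B))"
    have \<delta>: "\<delta> > 0" "sqrt B' * sqrt B * \<delta> = e / 3"
      using \<open>e > 0\<close> B by (auto simp: \<delta>_def field_simps)
    define F where "F = {k\<in>K. norm (m k) \<ge> \<delta>}"
    have F: "finite F" "F \<subseteq> K"
      using m \<delta> by (auto simp: c0_def F_def)
    define m1 where "m1 k = (if k \<in> F then 0 else m k)" for k
    have m1: "norm (m1 k) \<le> \<delta>" if "k \<in> K" for k
      using that \<delta>(1) by (auto simp: m1_def F_def)
    have split: "?M f = (\<Sum>k\<in>F. (m k * cinner f (\<psi> k)) *\<^sub>C \<phi> k) + bessel_multiplier K m1 \<phi> \<psi> f" for f
    proof (rule has_sum_unique[OF bessel_multiplier_has_sum[OF bessel linf]])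
      let ?h = "\<lambda>k. if k \<in> F then (m k * cinner f (\<psi> k)) *\<^sub>C \<phi> k else 0"
      have "(?h has_sum (\<Sum>k\<in>F. (m k * cinner f (\<psi> k)) *\<^sub>C \<phi> k)) K"
        by (rule has_sum_finite_neutralI[OF F]) auto
      from has_sum_add[OF this bessel_multiplier_has_sum[OF bessel linfI[OF m1]]]
      show "((\<lambda>k. (m k * cinner f (\<psi> k)) *\<^sub>C \<phi> k) has_sum
          (\<Sum>k\<in>F. (m k * cinner f (\<psi> k)) *\<^sub>C \<phi> k) + bessel_multiplier K m1 \<phi> \<psi> f) K"
        by (rule has_sum_cong[THEN iffD1, rotated]) (auto simp: m1_def)
    qed
    obtain C where C: "compact C"
      "\<And>c. (\<forall>k\<in>F. norm (c k) \<le> linf_norm K m * sqrt B) \<Longrightarrow> (\<Sum>k\<in>F. c k *\<^sub>C \<phi> k) \<in> C"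
      using compact_superset_combinations[OF F(1), of "linf_norm K m * sqrt B" \<phi>] by blast
    obtain S where S: "finite S" "C \<subseteq> (\<Union>x\<in>S. ball x (e / 3))"
      using C(1) \<open>e > 0\<close> unfolding compact_eq_totally_bounded by (metis divide_pos_pos zero_less_numeral)
    \<comment> \<open>Closed balls, because their finite union is closed and so absorbs the closure;
      radius \<open>2 * e / 3 < e\<close> returns to open balls afterwards.\<close>
    have "?M f \<in> (\<Union>x\<in>S. cball x (2 * e / 3))" if f: "f \<in> cball 0 1" for f
    proof -
      have "norm (m k * cinner f (\<psi> k)) \<le> linf_norm K m * sqrt B" if "k \<in> F" for k
      proof -
        have k: "k \<in> K"
          using that F(2) by blast
        have "norm (cinner f (\<psi> k)) \<le> norm f * norm (\<psi> k)"
          by (rule norm_cinner_le)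
        also have "\<dots> \<le> 1 * sqrt B"
          using f bessel_seq_norm_le[OF bessel(1) k] by (intro mult_mono) auto
        finally show ?thesis
          unfolding norm_mult using norm_le_linf_norm[OF linf k] by (intro mult_mono) (auto intro: order.trans[OF norm_ge_zero])
      qed
      then have "(\<Sum>k\<in>F. (m k * cinner f (\<psi> k)) *\<^sub>C \<phi> k) \<in> C"
        by (intro C(2)) auto
      then obtain x where x: "x \<in> S" "dist x (\<Sum>k\<in>F. (m k * cinner f (\<psi> k)) *\<^sub>C \<phi> k) < e / 3"
        using S(2) by auto
      have "norm (bessel_multiplier K m1 \<phi> \<psi> f) \<le> e / 3 * norm f"
        using bessel_multiplier_norm_le[OF bessel m1] \<delta> by fastforce
      also have "\<dots> \<le> e / 3"
        using f \<open>e > 0\<close> by (simp add: mult_left_le)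
      finally have "dist (\<Sum>k\<in>F. (m k * cinner f (\<psi> k)) *\<^sub>C \<phi> k) (?M f) \<le> e / 3"
        by (simp add: split dist_norm)
      with x(2) have "dist x (?M f) \<le> 2 * e / 3"
        using dist_triangle[of x "?M f" "\<Sum>k\<in>F. (m k * cinner f (\<psi> k)) *\<^sub>C \<phi> k"] by linarith
      then show ?thesis
        using x(1) by auto
    qed
    then have "closure (?M ` cball 0 1) \<subseteq> (\<Union>x\<in>S. cball x (2 * e / 3))"
      using S(1) by (intro closure_minimal closed_UN) auto
    also have "\<dots> \<subseteq> (\<Union>x\<in>S. ball x e)"
      using \<open>e > 0\<close> by (intro UN_mono) auto
    finally show ?thesis
      using S(1) by blast
  qed
  have "complete (closure (?M ` cball 0 1))"
    by (simp add: complete_eq_closed)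
  with approx have "compact (closure (?M ` cball 0 1))"
    unfolding compact_eq_totally_bounded by blast
  then show ?thesis
    using bounded_clinear_bessel_multiplier[OF bessel linf] by (simp add: compact_op_def)
qed

section \<open>Orthonormal bases\<close>

text \<open>\<open>is_onb\<close> without its completeness clause: the part that survives passing to
  subsets and to unions of chains.\<close>

definition orthonormal :: "'a::complex_inner set \<Rightarrow> bool" where
  "orthonormal E \<longleftrightarrow> (\<forall>e\<in>E. norm e = 1) \<and> (\<forall>e\<in>E. \<forall>e'\<in>E. e \<noteq> e' \<longrightarrow> cinner e e' = 0)"

lemma is_onb_orthonormal: "is_onb E \<Longrightarrow> orthonormal E"
  by (auto simp: is_onb_def orthonormal_def)

lemma orthonormal_subset: "orthonormal E \<Longrightarrow> F \<subseteq> E \<Longrightarrow> orthonormal F"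
  by (auto simp: orthonormal_def)

text \<open>Pair \<open>x\<close> with \<open>y\<close>, its would-be projection:
  \<open>L\<^sup>2 = cinner x y\<close> and \<open>norm y \<le> L\<close>. An indexed family with
  norms at most 1, rather than a set of unit vectors, admits repeated zero vectors; these occur when
  images \<open>M e\<close> are normalised and some vanish.\<close>

lemma bessel_inequality_finite:
  fixes f :: "'i \<Rightarrow> 'a::complex_inner"
  assumes "finite F" "\<And>i. i \<in> F \<Longrightarrow> norm (f i) \<le> 1"
    and "\<And>i j. i \<in> F \<Longrightarrow> j \<in> F \<Longrightarrow> i \<noteq> j \<Longrightarrow> cinner (f i) (f j) = 0"
  shows "L2_set (\<lambda>i. norm (cinner x (f i))) F \<le> norm x"
proof -
  define L where "L = L2_set (\<lambda>i. norm (cinner x (f i))) F"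
  have L: "L\<^sup>2 = (\<Sum>i\<in>F. (norm (cinner x (f i)))\<^sup>2)" "L \<ge> 0"
    by (auto simp: L_def L2_set_def sum_nonneg)
  define y where "y = (\<Sum>i\<in>F. cinner x (f i) *\<^sub>C f i)"
  have xy: "cinner x y = of_real (L\<^sup>2)"
    unfolding y_def cinner_sum_right cinner_scaleC_right L(1) of_real_sum complex_norm_square
    by (simp add: mult.commute)
  have fy: "cinner (f i) y = cnj (cinner x (f i)) * of_real ((norm (f i))\<^sup>2)" if "i \<in> F" for i
  proof -
    have "cinner (f i) y = (\<Sum>j\<in>F. if j = i then cnj (cinner x (f i)) * of_real ((norm (f i))\<^sup>2) else 0)"
      unfolding y_def cinner_sum_right cinner_scaleC_right
      by (rule sum.cong) (use assms(3) that in \<open>auto simp: cinner_self\<close>)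
    then show ?thesis
      using assms(1) that by simp
  qed
  have "norm y * norm y = norm (\<Sum>i\<in>F. cinner x (f i) * cinner (f i) y)"
    unfolding norm_cinner_self[symmetric] by (subst y_def) (simp add: cinner_sum_left cinner_scaleC_left)
  also have "\<dots> \<le> (\<Sum>i\<in>F. (norm (cinner x (f i)))\<^sup>2 * (norm (f i))\<^sup>2)"
    by (rule sum_norm_le) (simp add: fy norm_mult norm_power power2_eq_square)
  also have "\<dots> \<le> L\<^sup>2"
    unfolding L(1) using assms(2) by (intro sum_mono) (simp add: mult_left_le power_le_one)
  finally have "norm y \<le> L"
    using power2_le_imp_le[OF _ L(2)] unfolding power2_eq_square by blast
  have "L\<^sup>2 = norm (cinner x y)"
    by (simp add: xy norm_power L(2))
  also have "\<dots> \<le> norm x * norm y"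
    by (rule norm_cinner_le)
  also have "\<dots> \<le> norm x * L"
    using \<open>norm y \<le> L\<close> by (intro mult_left_mono) auto
  finally have "L * L \<le> norm x * L"
    by (simp add: power2_eq_square)
  then show ?thesis
    using L(2) unfolding L_def[symmetric] by (cases "L = 0") auto
qed

lemma orthonormal_L2_set_le:
  assumes "orthonormal E" "finite F" "F \<subseteq> E"
  shows "L2_set (\<lambda>e. norm (cinner x e)) F \<le> norm x"
  by (rule bessel_inequality_finite) (use assms in \<open>auto simp: orthonormal_def\<close>)

text \<open>A basis indexed by itself is a Bessel sequence, so operators diagonal in it are
  themselves multipliers and inherit every multiplier lemma.\<close>

lemma bessel_seq_orthonormal:
  fixes E :: "'a::complex_hilbert_space set"
  assumes "orthonormal E"
  shows "bessel_seq E (\<lambda>e. e) 1"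
proof -
  have le: "(\<Sum>e\<in>F. (norm (cinner x e))\<^sup>2) \<le> (norm x)\<^sup>2" if "finite F" "F \<subseteq> E" for F and x :: 'a
    using orthonormal_L2_set_le[OF assms that, of x] unfolding L2_set_def
    by (metis norm_ge_zero real_sqrt_le_iff real_sqrt_abs abs_of_nonneg)
  have "(\<lambda>e. (norm (cinner x e))\<^sup>2) summable_on E" for x :: 'a
    by (rule nonneg_bdd_above_summable_on) (use le in \<open>auto simp: bdd_above_def\<close>)
  then show ?thesis
    using le by (auto simp: bessel_seq_def intro!: infsum_le_finite_sums)
qed

text \<open>The series converges by the Bessel property alone; its difference to \<open>x\<close> is
  orthogonal to all of \<open>E\<close>, and the completeness clause of \<open>is_onb\<close> makes
  it vanish.\<close>

lemma onb_expansion: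
  assumes "is_onb E"
  shows "((\<lambda>e. cinner x e *\<^sub>C e) has_sum x) E"
proof -
  note bessel = bessel_seq_orthonormal[OF is_onb_orthonormal[OF assms]]
  let ?y = "\<Sum>\<^sub>\<infinity>e\<in>E. cinner x e *\<^sub>C e"
  have hs: "((\<lambda>e. cinner x e *\<^sub>C e) has_sum ?y) E"
    using bessel_synthesis_summable[OF bessel, of "cinner x"] bessel by (simp add: bessel_seq_def)
  have "cinner (x - ?y) e = 0" if "e \<in> E" for e
  proof -
    have "((\<lambda>e'. cinner x e' * cinner e' e) has_sum cinner ?y e) E"
      using has_sum_bounded_linear[OF bounded_linear_cinner_left hs] by (simp add: cinner_scaleC_left)
    moreover have "((\<lambda>e'. cinner x e' * cinner e' e) has_sum cinner x e) E"
      by (rule has_sum_finite_neutralI[of "{e}"])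
         (use that assms in \<open>auto simp: is_onb_def cinner_self\<close>)
    ultimately show ?thesis
      using has_sum_unique by (fastforce simp: cinner_diff_left)
  qed
  then have "x - ?y = 0"
    using assms unfolding is_onb_def by blast
  then show ?thesis
    using hs by simp
qed

lemma onb_parseval:
  assumes "is_onb E"
  shows "((\<lambda>e. cinner x e * cinner e y) has_sum cinner x y) E"
  using has_sum_bounded_linear[OF bounded_linear_cinner_left onb_expansion[OF assms, of x]]
  by (simp add: cinner_scaleC_left)

lemma onb_parseval_norm:
  assumes "is_onb E"
  shows "((\<lambda>e. (norm (cinner x e))\<^sup>2) has_sum (norm x)\<^sup>2) E"
proof -
  have "cinner x e * cinner e x = of_real ((norm (cinner x e))\<^sup>2)" for e
    unfolding complex_norm_square using cinner_commute[of e x] by simp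
  then show ?thesis
    using onb_parseval[OF assms, of x x] unfolding cinner_self
    by (simp only: has_sum_of_real_iff)
qed

lemma bounded_clinear_eq_on_onb:
  assumes "is_onb E" "bounded_clinear A" "bounded_clinear A'" "\<And>e. e \<in> E \<Longrightarrow> A e = A' e"
  shows "A = A'"
proof
  fix x
  have hs: "((\<lambda>e. cinner x e *\<^sub>C C e) has_sum C x) E" if "bounded_clinear C" for C :: "'a \<Rightarrow> 'b"
    using has_sum_bounded_linear[OF _ onb_expansion[OF assms(1), of x], of C] that
    by (simp add: bounded_clinear_def)
  have "((\<lambda>e. cinner x e *\<^sub>C A e) has_sum A' x) E"
    using hs[OF assms(3)] by (rule has_sum_cong[THEN iffD1, rotated]) (simp add: assms(4))
  then show "A x = A' x"
    using hs[OF assms(2)] has_sum_unique by blast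
qed

section \<open>Diagonalisation of the positive operator of a compact operator\<close>

lemma bounded_clinear_scaleR: "bounded_clinear A \<Longrightarrow> A (r *\<^sub>R x) = r *\<^sub>R A x"
  by (simp add: bounded_clinear_def scaleR_scaleC)

text \<open>
  The eigenvector is a maximiser of \<open>norm (M x)\<close> over the unit sphere of the orthogonal
  complement of \<open>E\<close>, which is invariant under \<open>M\<^sup>* M\<close>.
\<close>

lemma compact_op_eigenvector_orthogonal:
  fixes M :: "'a::complex_hilbert_space \<Rightarrow> 'b::complex_hilbert_space"
  assumes M: "compact_op M" and M': "bounded_clinear M'"
    and adj: "\<And>x y. cinner (M x) y = cinner x (M' y)"
    and E: "\<And>e. e \<in> E \<Longrightarrow> M' (M e) = complex_of_real ((norm (M e))\<^sup>2) *\<^sub>C e"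
    and x0: "x0 \<noteq> 0" "\<And>e. e \<in> E \<Longrightarrow> cinner x0 e = 0"
  obtains x where "norm x = 1" "\<And>e. e \<in> E \<Longrightarrow> cinner x e = 0"
    "M' (M x) = complex_of_real ((norm (M x))\<^sup>2) *\<^sub>C x"
proof -
  have clM: "bounded_clinear M"
    using M by (simp add: compact_op_def)
  then have blM: "bounded_linear M" and blM': "bounded_linear M'"
    using M' by (auto simp: bounded_clinear_def)
  have adj': "cinner (M' y) x = cinner y (M x)" for x y
    using adj[of x y] by (metis cinner_commute)
  define N where "N = {x. \<forall>e\<in>E. cinner x e = 0}"
  \<comment> \<open>Moving \<open>M' \<circ> M\<close> to the other side hits an eigenvector
    \<open>e\<close> and only rescales it.\<close>
  have TN: "M' (M x) \<in> N" if "x \<in> N" for x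
    using that by (auto simp: N_def adj' adj E cinner_scaleC_right)
  have scaleN: "r *\<^sub>R x \<in> N" if "x \<in> N" for r x
    using that by (auto simp: N_def scaleR_scaleC cinner_scaleC_left)
  define U where "U = {x\<in>N. norm x = 1}"
  have "(1 / norm x0) *\<^sub>R x0 \<in> U"
    using x0 scaleN[of x0] by (auto simp: U_def N_def)
  then have "U \<noteq> {}" by blast
  have bdd: "bdd_above ((\<lambda>x. norm (M x)) ` U)"
    using onorm[OF blM] by (intro bdd_aboveI[of _ "onorm M"]) (auto simp: U_def, metis mult.right_neutral)
  define \<mu> where "\<mu> = (SUP x\<in>U. norm (M x))"
  have le_U: "norm (M x) \<le> \<mu>" if "x \<in> U" for x
    unfolding \<mu>_def using that bdd by (rule cSUP_upper)
  then have "\<mu> \<ge> 0"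
    using \<open>U \<noteq> {}\<close> norm_ge_zero order.trans by blast
  have le_N: "norm (M x) \<le> \<mu> * norm x" if "x \<in> N" for x
  proof (cases "x = 0")
    case True
    then show ?thesis
      using linear_0[OF bounded_linear.linear[OF blM]] by simp
  next
    case False
    then have "norm (M ((1 / norm x) *\<^sub>R x)) \<le> \<mu>"
      using scaleN[OF that] by (intro le_U) (auto simp: U_def)
    then show ?thesis
      using False by (simp add: bounded_clinear_scaleR[OF clM] field_simps)
  qed
  \<comment> \<open>The squared norm is the pairing of \<open>M x\<close> with
    \<open>M (M' (M x))\<close>; by invariance of \<open>N\<close> the bound \<mu> applies to both
    factors, and one norm cancels.\<close>
  have le_T: "norm (M' (M x)) \<le> \<mu>\<^sup>2 * norm x" if "x \<in> N" for x
  proof -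
    have "norm (M' (M x)) * norm (M' (M x)) = norm (cinner (M x) (M (M' (M x))))"
      unfolding norm_cinner_self[symmetric] adj' ..
    also have "\<dots> \<le> norm (M x) * norm (M (M' (M x)))"
      by (rule norm_cinner_le)
    also have "\<dots> \<le> (\<mu> * norm x) * (\<mu> * norm (M' (M x)))"
      using le_N TN that \<open>\<mu> \<ge> 0\<close> by (intro mult_mono) auto
    finally have "norm (M' (M x)) * norm (M' (M x)) \<le> (\<mu>\<^sup>2 * norm x) * norm (M' (M x))"
      by (simp add: power2_eq_square mult_ac)
    then show ?thesis
      by (cases "M' (M x) = 0") auto
  qed
  have Re_T: "Re (cinner (M' (M x)) x) = (norm (M x))\<^sup>2" for x
    by (simp add: adj' cinner_self)
  \<comment> \<open>Quantifies that near-maximisers of \<open>norm (M x)\<close> are approximate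
    eigenvectors for \<open>\<mu>\<^sup>2\<close>: the mixed term of the expanded square is exactly
    \<open>(norm (M x))\<^sup>2\<close>.\<close>
  have norm_diff: "(norm (M' (M x) - \<mu>\<^sup>2 *\<^sub>R x))\<^sup>2 \<le> 2 * \<mu>\<^sup>2 * (\<mu>\<^sup>2 - (norm (M x))\<^sup>2)" if "x \<in> U" for x
  proof -
    have "(norm (M' (M x) - \<mu>\<^sup>2 *\<^sub>R x))\<^sup>2
        = (norm (M' (M x)))\<^sup>2 + (norm (\<mu>\<^sup>2 *\<^sub>R x))\<^sup>2 - 2 * (M' (M x) \<bullet> (\<mu>\<^sup>2 *\<^sub>R x))"
      unfolding power2_norm_eq_inner by (simp add: inner_diff inner_commute)
    also have "\<dots> = (norm (M' (M x)))\<^sup>2 + \<mu>\<^sup>2 * \<mu>\<^sup>2 - 2 * \<mu>\<^sup>2 * (norm (M x))\<^sup>2"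
      using that by (simp add: inner_Re_cinner[symmetric] Re_T[unfolded inner_Re_cinner[symmetric]] U_def power2_eq_square)
    also have "(norm (M' (M x)))\<^sup>2 \<le> (\<mu>\<^sup>2)\<^sup>2"
      using le_T[of x] that by (intro power_mono) (auto simp: U_def)
    finally show ?thesis
      by (simp add: algebra_simps power2_eq_square)
  qed
  show ?thesis
  proof (cases "\<mu> = 0")
    \<comment> \<open>Here \<open>M\<close> vanishes on the complement, so any unit vector in it
      serves.\<close>
    case True
    obtain x where "x \<in> U"
      using \<open>U \<noteq> {}\<close> by blast
    then have "M x = 0"
      using le_U[of x] True by simp
    then show ?thesis
      using \<open>x \<in> U\<close> linear_0[OF bounded_linear.linear[OF blM']]
      by (intro that[of x]) (auto simp: U_def N_def)
  next
    case False
    have "\<exists>x\<in>U. \<mu> - 1 / (real n + 1) < norm (M x)" for n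
      unfolding \<mu>_def by (rule less_cSUP_iff[THEN iffD1]) (use \<open>U \<noteq> {}\<close> bdd in \<open>auto simp flip: \<mu>_def\<close>)
    then obtain X where X: "\<And>n. X n \<in> U" "\<And>n. \<mu> - 1 / (real n + 1) < norm (M (X n))"
      by metis
    have "M (X n) \<in> closure (M ` cball 0 1)" for n
      using X(1)[of n] by (intro closure_subset[THEN subsetD]) (auto simp: U_def)
    then obtain z r where r: "strict_mono (r :: nat \<Rightarrow> nat)" "((\<lambda>n. M (X n)) \<circ> r) \<longlonglongrightarrow> z"
      using M unfolding compact_op_def compact_def by metis
    have lim_norm: "(\<lambda>n. norm (M (X n))) \<longlonglongrightarrow> \<mu>"
    proof (rule real_tendsto_sandwich[where h = "\<lambda>_. \<mu>"])
      show "(\<lambda>n. \<mu> - 1 / (real n + 1)) \<longlonglongrightarrow> \<mu>"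
        using tendsto_diff[OF tendsto_const LIMSEQ_inverse_real_of_nat, of \<mu>]
        by (simp add: inverse_eq_divide add.commute)
    qed (simp_all add: less_imp_le[OF X(2)] le_U[OF X(1)])
    have "(\<lambda>n. sqrt (2 * \<mu>\<^sup>2 * (\<mu>\<^sup>2 - (norm (M (X n)))\<^sup>2))) \<longlonglongrightarrow> sqrt (2 * \<mu>\<^sup>2 * (\<mu>\<^sup>2 - \<mu>\<^sup>2))"
      by (intro tendsto_intros lim_norm)
    then have lim0: "(\<lambda>n. sqrt (2 * \<mu>\<^sup>2 * (\<mu>\<^sup>2 - (norm (M (X n)))\<^sup>2))) \<longlonglongrightarrow> 0"
      by simp
    have "norm (M' (M (X n)) - \<mu>\<^sup>2 *\<^sub>R X n) \<le> sqrt (2 * \<mu>\<^sup>2 * (\<mu>\<^sup>2 - (norm (M (X n)))\<^sup>2))" for n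
      by (rule real_le_rsqrt[OF norm_diff[OF X(1)]])
    from Lim_null_comparison[OF always_eventually[OF allI[OF this]] lim0]
    have diff0: "(\<lambda>n. M' (M (X n)) - \<mu>\<^sup>2 *\<^sub>R X n) \<longlonglongrightarrow> 0"
      .
    have diff0': "(\<lambda>n. M' (M (X (r n))) - \<mu>\<^sup>2 *\<^sub>R X (r n)) \<longlonglongrightarrow> 0"
      using LIMSEQ_subseq_LIMSEQ[OF diff0 r(1)] by (simp add: o_def)
    \<comment> \<open>Compactness only makes the images \<open>M (X (r n))\<close> converge, to
      \<open>z\<close>. Applying \<open>M'\<close> and comparing with
      \<open>\<mu>\<^sup>2 *\<^sub>R X (r n)\<close> forces the vectors themselves to converge to
      this \<open>x\<close>.\<close>
    define x where "x = (1 / \<mu>\<^sup>2) *\<^sub>R M' z"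
    have "(\<lambda>n. M' (M (X (r n)))) \<longlonglongrightarrow> M' z"
      using r(2) by (intro bounded_linear.tendsto[OF blM']) (simp add: o_def)
    from tendsto_diff[OF this diff0']
    have "(\<lambda>n. (1 / \<mu>\<^sup>2) *\<^sub>R (\<mu>\<^sup>2 *\<^sub>R X (r n))) \<longlonglongrightarrow> x"
      unfolding x_def by (intro tendsto_scaleR tendsto_const) simp
    then have lim: "(\<lambda>n. X (r n)) \<longlonglongrightarrow> x"
      using False by simp
    have "(\<lambda>n. norm (X (r n))) \<longlonglongrightarrow> norm x"
      by (intro tendsto_norm lim)
    then have "norm x = 1"
      using X(1) by (simp add: U_def LIMSEQ_const_iff)
    have "cinner x e = 0" if "e \<in> E" for e
    proof -
      have "(\<lambda>n. cinner (X (r n)) e) \<longlonglongrightarrow> cinner x e"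
        by (intro bounded_linear.tendsto[OF bounded_linear_cinner_left] lim)
      then show ?thesis
        using X(1) that by (simp add: U_def N_def LIMSEQ_const_iff)
    qed
    have "(\<lambda>n. M' (M (X (r n))) - \<mu>\<^sup>2 *\<^sub>R X (r n)) \<longlonglongrightarrow> M' (M x) - \<mu>\<^sup>2 *\<^sub>R x"
      by (intro tendsto_diff tendsto_scaleR tendsto_const lim
          bounded_linear.tendsto[OF blM'] bounded_linear.tendsto[OF blM])
    then have eig: "M' (M x) = \<mu>\<^sup>2 *\<^sub>R x"
      using LIMSEQ_unique[OF diff0'] by fastforce
    have "(norm (M x))\<^sup>2 = \<mu>\<^sup>2"
      unfolding Re_T[symmetric] eig using \<open>norm x = 1\<close>
      by (simp add: scaleR_scaleC cinner_scaleC_left cinner_self)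
    then show ?thesis
      using \<open>norm x = 1\<close> \<open>\<And>e. e \<in> E \<Longrightarrow> cinner x e = 0\<close> eig
      by (intro that[of x]) (simp_all add: scaleR_scaleC)
  qed
qed

text \<open>Zorn's lemma on orthonormal sets of eigenvectors: a maximal one is complete, since a
  nonzero vector orthogonal to it would yield a further eigenvector. The eigenvalue at a unit vector
  can only be \<open>(norm (M e))\<^sup>2\<close>, so no separate family of eigenvalues is
  carried.\<close>

lemma compact_op_eigenbasis:
  fixes M :: "'a::complex_hilbert_space \<Rightarrow> 'b::complex_hilbert_space"
  assumes M: "compact_op M" and M': "bounded_clinear M'"
    and adj: "\<And>x y. cinner (M x) y = cinner x (M' y)"
  obtains E where "is_onb E" "\<And>e. e \<in> E \<Longrightarrow> M' (M e) = complex_of_real ((norm (M e))\<^sup>2) *\<^sub>C e"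
proof -
  define eigs where "eigs = {x. M' (M x) = complex_of_real ((norm (M x))\<^sup>2) *\<^sub>C x}"
  have "\<exists>E\<in>{E. orthonormal E \<and> E \<subseteq> eigs}. \<forall>X\<in>{E. orthonormal E \<and> E \<subseteq> eigs}. E \<subseteq> X \<longrightarrow> X = E"
  proof (rule subset_Zorn')
    fix C assume C: "subset.chain {E. orthonormal E \<and> E \<subseteq> eigs} C"
    then have sub: "orthonormal X \<and> X \<subseteq> eigs" if "X \<in> C" for X
      using that by (auto simp: subset.chain_def)
    have "\<exists>X\<in>C. x \<in> X \<and> y \<in> X" if "x \<in> \<Union>C" "y \<in> \<Union>C" for x y
      using that C unfolding subset_chain_def by blast
    then have "orthonormal (\<Union>C)"
      using sub unfolding orthonormal_def by (meson UnionE)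
    then show "\<Union>C \<in> {E. orthonormal E \<and> E \<subseteq> eigs}"
      using sub by blast
  qed
  then obtain E where E: "orthonormal E" "E \<subseteq> eigs"
      "\<And>X. orthonormal X \<Longrightarrow> X \<subseteq> eigs \<Longrightarrow> E \<subseteq> X \<Longrightarrow> X = E"
    unfolding mem_Collect_eq Bex_def Ball_def by metis
  have "x0 = 0" if x0: "\<forall>e\<in>E. cinner x0 e = 0" for x0
  proof (rule ccontr)
    assume "x0 \<noteq> 0"
    then obtain x where x: "norm x = 1" "\<And>e. e \<in> E \<Longrightarrow> cinner x e = 0" "x \<in> eigs"
      using compact_op_eigenvector_orthogonal[OF M M' adj, of E x0] x0 E(2) unfolding eigs_def by blast
    have "cinner e x = 0" if "e \<in> E" for e
      using x(2)[OF that] cinner_commute[of e x] by simp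
    \<comment> \<open>Maximality puts \<open>x\<close> into \<open>E\<close>; being orthogonal to
      all of \<open>E\<close>, it is then orthogonal to itself.\<close>
    then have "insert x E = E"
      using E x by (intro E(3)) (auto simp: orthonormal_def)
    then have "cinner x x = 0"
      using x(2) by blast
    then show False
      using x(1) by (simp add: cinner_self)
  qed
  then have "is_onb E"
    using E(1) by (simp add: is_onb_def orthonormal_def)
  with that E(2) show ?thesis
    unfolding eigs_def by blast
qed

text \<open>Every vector is an eigenvector of the zero operator. Without some basis the conditions
  defining the trace and the Hilbert-Schmidt norm would hold vacuously for every value.\<close>

lemma ex_onb: "\<exists>E :: 'a::complex_hilbert_space set. is_onb E"
proof -
  have "bounded_clinear (\<lambda>x :: 'a. 0 :: 'a)"
    by (simp add: bounded_clinear_def bounded_linear_zero)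
  moreover from this have "compact_op (\<lambda>x :: 'a. 0 :: 'a)"
    by (simp add: compact_op_def image_constant_conv)
  ultimately show ?thesis
    using compact_op_eigenbasis[of "\<lambda>x :: 'a. 0 :: 'a" "\<lambda>x. 0"] by auto
qed

section \<open>The absolute value of a compact operator\<close>

text \<open>Polarisation: reality of the form at \<open>x + y\<close> relates the imaginary parts,
  and at \<open>x + \<i> *\<^sub>C y\<close> the real parts.\<close>

lemma clinear_real_form_hermitian:
  assumes "bounded_clinear Q" and real: "\<And>x. cinner (Q x) x \<in> \<real>"
  shows "cinner (Q x) y = cinner x (Q y)"
proof -
  have add: "Q (u + v) = Q u + Q v" and scale: "Q (c *\<^sub>C u) = c *\<^sub>C Q u" for u v c
    using assms(1) linear_add[OF bounded_linear.linear] by (auto simp: bounded_clinear_def)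
  have Im0: "Im (cinner (Q z) z) = 0" for z
    using real[of z] by (simp add: complex_is_Real_iff)
  have "Im (cinner (Q x) y) + Im (cinner (Q y) x) = 0"
    using Im0[of "x + y"] Im0[of x] Im0[of y] by (simp add: add cinner_add_left cinner_add_right)
  moreover have "Re (cinner (Q y) x) - Re (cinner (Q x) y) = 0"
    using Im0[of "x + \<i> *\<^sub>C y"] Im0[of x] Im0[of y]
    by (simp add: add scale cinner_add_left cinner_add_right cinner_scaleC_left cinner_scaleC_right)
  ultimately have "cinner (Q x) y = cnj (cinner (Q y) x)"
    by (simp add: complex_eq_iff)
  then show ?thesis
    by (metis cinner_commute)
qed

lemma positive_op_hermitian:
  assumes "positive_op Q"
  shows "cinner (Q x) y = cinner x (Q y)"
  using assms by (intro clinear_real_form_hermitian) (auto simp: positive_op_def nonneg_Reals_subset_Reals[THEN subsetD])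

text \<open>
  An eigenvector of \<open>Q\<^sup>2\<close> for \<open>s\<^sup>2\<close> is one of \<open>Q\<close> for \<open>s\<close>, since \<open>y = Q e - s e\<close> satisfies
  \<open>Q y = - s y\<close>. This gives uniqueness of the positive square root without functional calculus.
\<close>

lemma positive_op_eigenvector_sqrt:
  assumes Q: "positive_op Q" and s: "s \<ge> 0" and QQ: "Q (Q e) = complex_of_real (s\<^sup>2) *\<^sub>C e"
  shows "Q e = complex_of_real s *\<^sub>C e"
proof (cases "s = 0")
  \<comment> \<open>Treated apart because the sign argument below needs \<open>s > 0\<close>; here
    hermiticity alone gives \<open>Q e = 0\<close>.\<close>
  case True
  have "cinner (Q e) (Q e) = cinner e (Q (Q e))"
    by (rule positive_op_hermitian[OF Q])
  then have "norm (Q e) * norm (Q e) = 0"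
    unfolding norm_cinner_self[symmetric] using QQ True by simp
  then show ?thesis
    using True by simp
next
  case False
  have cl: "bounded_clinear Q"
    using Q by (simp add: positive_op_def)
  then have bl: "bounded_linear Q"
    by (simp add: bounded_clinear_def)
  define y where "y = Q e - s *\<^sub>R e"
  have "Q y = (- s) *\<^sub>R y"
    unfolding y_def linear_diff[OF bounded_linear.linear[OF bl]] bounded_clinear_scaleR[OF cl] QQ scaleR_scaleC[symmetric]
    by (simp add: scaleR_diff_right power2_eq_square)
  then have "cinner (Q y) y = complex_of_real (- s * (norm y)\<^sup>2)"
    by (simp only: scaleR_scaleC cinner_scaleC_left cinner_self of_real_mult)
  moreover have "cinner (Q y) y \<in> \<real>\<^sub>\<ge>\<^sub>0"
    using Q by (simp add: positive_op_def)
  ultimately have "- s * (norm y)\<^sup>2 \<ge> 0"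
    by (simp only: nonneg_Reals_of_real_iff)
  then have "y = 0"
    using s False by (simp add: mult_le_0_iff)
  then show ?thesis
    by (simp add: y_def scaleR_scaleC)
qed

lemma bessel_multiplier_orthonormal_basis_vector:
  assumes "orthonormal E" "e \<in> E"
  shows "bessel_multiplier E m (\<lambda>e. e) (\<lambda>e. e) e = m e *\<^sub>C e"
  unfolding bessel_multiplier_def
  by (rule infsumI, rule has_sum_finite_neutralI[of "{e}"])
     (use assms in \<open>auto simp: orthonormal_def cinner_self\<close>)

lemma positive_op_bessel_multiplier:
  assumes "orthonormal E" "(\<lambda>e. complex_of_real (s e)) \<in> linf E" "\<And>e. e \<in> E \<Longrightarrow> s e \<ge> 0"
  shows "positive_op (bessel_multiplier E (\<lambda>e. complex_of_real (s e)) (\<lambda>e. e) (\<lambda>e. e))" (is "positive_op ?P")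
proof -
  note bessel = bessel_seq_orthonormal[OF assms(1)]
  have "cinner (?P x) x \<in> \<real>\<^sub>\<ge>\<^sub>0" for x
  proof -
    have eq: "complex_of_real (s e) * cinner x e * cinner e x = complex_of_real (s e * (norm (cinner x e))\<^sup>2)" for e
      unfolding of_real_mult complex_norm_square using cinner_commute[of e x] by simp
    have hs: "((\<lambda>e. complex_of_real (s e * (norm (cinner x e))\<^sup>2)) has_sum cinner (?P x) x) E"
      using cinner_bessel_multiplier_has_sum[OF bessel bessel assms(2), of x x] unfolding eq .
    have "((\<lambda>e. s e * (norm (cinner x e))\<^sup>2) has_sum Re (cinner (?P x) x)) E"
      using has_sum_Re[OF hs] by simp
    then have "Re (cinner (?P x) x) \<ge> 0"
      by (rule has_sum_nonneg) (simp add: assms(3))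
    moreover have "Im (cinner (?P x) x) = 0"
      using has_sum_Im[OF hs] has_sum_unique[OF _ has_sum_0] by fastforce
    ultimately show ?thesis
      by (simp add: complex_nonneg_Reals_iff)
  qed
  then show ?thesis
    using bounded_clinear_bessel_multiplier[OF bessel bessel assms(2)] by (simp add: positive_op_def)
qed

lemma bounded_clinear_comp:
  assumes "bounded_clinear A" "bounded_clinear A'"
  shows "bounded_clinear (A \<circ> A')"
  using assms bounded_linear_compose[of A A'] by (auto simp: bounded_clinear_def o_def)

text \<open>Both \<open>?P \<circ> ?P\<close> and any competing root are compared on
  \<open>E\<close> only: there the square acts by \<open>(norm (M e))\<^sup>2\<close>, which forces
  a positive root to act by \<open>norm (M e)\<close>.\<close>

lemma abs_op_eigenbasis:
  fixes M :: "'a::complex_hilbert_space \<Rightarrow> 'b::complex_hilbert_space"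
  assumes M: "bounded_clinear M" and M': "bounded_clinear M'"
    and adj: "\<And>x y. cinner (M x) y = cinner x (M' y)"
    and E: "is_onb E" "\<And>e. e \<in> E \<Longrightarrow> M' (M e) = complex_of_real ((norm (M e))\<^sup>2) *\<^sub>C e"
  shows "abs_op M = bessel_multiplier E (\<lambda>e. complex_of_real (norm (M e))) (\<lambda>e. e) (\<lambda>e. e)" (is "_ = ?P")
proof -
  note on = is_onb_orthonormal[OF E(1)]
  note bessel = bessel_seq_orthonormal[OF on]
  have "bounded_linear M"
    using M by (simp add: bounded_clinear_def)
  then have "norm (M e) \<le> onorm M" if "e \<in> E" for e
    using onorm[of M e] that on by (simp add: orthonormal_def)
  then have linf: "(\<lambda>e. complex_of_real (norm (M e))) \<in> linf E"
    by (intro linfI) simp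
  have clP: "bounded_clinear ?P"
    by (rule bounded_clinear_bessel_multiplier[OF bessel bessel linf])
  have P: "?P e = complex_of_real (norm (M e)) *\<^sub>C e" if "e \<in> E" for e
    by (rule bessel_multiplier_orthonormal_basis_vector[OF on that])
  have scaleP: "?P (c *\<^sub>C x) = c *\<^sub>C ?P x" for c x
    using clP by (simp add: bounded_clinear_def)
  have PP: "?P \<circ> ?P = M' \<circ> M"
  proof (rule bounded_clinear_eq_on_onb[OF E(1)])
    fix e assume "e \<in> E"
    then show "(?P \<circ> ?P) e = (M' \<circ> M) e"
      by (simp add: P scaleP E(2) scaleC_scaleC power2_eq_square)
  qed (intro bounded_clinear_comp clP M M')+
  have cadj: "cadjoint M = M'"
    by (rule cadjoint_eqI) (rule adj)
  show ?thesis
    unfolding abs_op_def cadj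
  proof (rule the_equality)
    show "positive_op ?P \<and> ?P \<circ> ?P = M' \<circ> M"
      using positive_op_bessel_multiplier[OF on linf] PP by simp
    fix Q assume Q: "positive_op Q \<and> Q \<circ> Q = M' \<circ> M"
    show "Q = ?P"
    proof (rule bounded_clinear_eq_on_onb[OF E(1) _ clP])
      show "bounded_clinear Q"
        using Q by (simp add: positive_op_def)
      fix e assume "e \<in> E"
      have "Q (Q e) = complex_of_real ((norm (M e))\<^sup>2) *\<^sub>C e"
        using Q E(2)[OF \<open>e \<in> E\<close>] by (metis comp_apply)
      then have "Q e = complex_of_real (norm (M e)) *\<^sub>C e"
        using Q positive_op_eigenvector_sqrt[OF _ norm_ge_zero] by blast
      then show "Q e = ?P e"
        by (simp add: P \<open>e \<in> E\<close>)
    qed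
  qed
qed

section \<open>Absolutely summable symbols\<close>

text \<open>The absolute form of Parseval's identity, by Cauchy-Schwarz and Bessel on finite sets.
  It supplies the domination needed to exchange sums in the trace formula.\<close>

lemma onb_abs_parseval:
  assumes "is_onb E"
  shows "(\<lambda>e. norm (cinner x e * cinner e y)) summable_on E" (is "?f summable_on E")
    and "(\<Sum>\<^sub>\<infinity>e\<in>E. norm (cinner x e * cinner e y)) \<le> norm x * norm y"
proof -
  note on = is_onb_orthonormal[OF assms]
  have le: "sum ?f F \<le> norm x * norm y" if "finite F" "F \<subseteq> E" for F
  proof -
    have "sum ?f F = (\<Sum>e\<in>F. \<bar>norm (cinner x e)\<bar> * \<bar>norm (cinner y e)\<bar>)"
      by (simp add: norm_mult norm_cinner_commute[of y])
    also have "\<dots> \<le> L2_set (\<lambda>e. norm (cinner x e)) F * L2_set (\<lambda>e. norm (cinner y e)) F"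
      by (rule L2_set_mult_ineq)
    also have "\<dots> \<le> norm x * norm y"
      using orthonormal_L2_set_le[OF on that] by (intro mult_mono) auto
    finally show ?thesis .
  qed
  show "?f summable_on E"
    by (rule nonneg_bdd_above_summable_on) (use le in \<open>auto simp: bdd_above_def\<close>)
  then show "infsum ?f E \<le> norm x * norm y"
    using le by (rule infsum_le_finite_sums)
qed

lemma lp1_iff: "m \<in> lp 1 K \<longleftrightarrow> (\<lambda>k. norm (m k)) summable_on K"
  by (simp add: lp_def)

lemma lp_norm_1: "lp_norm 1 K m = (\<Sum>\<^sub>\<infinity>k\<in>K. norm (m k))"
  by (simp add: lp_norm_def infsum_nonneg)

lemma lp1_linf: "m \<in> lp 1 K \<Longrightarrow> m \<in> linf K"
  by (intro c0_subset_linf lp_subset_c0) auto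

text \<open>Fubini for the family \<open>f\<close> on \<open>K \<times> E\<close>, whose rows have
  absolute sums at most \<open>sqrt B' * sqrt B * norm (m k)\<close>. Summing over \<open>K\<close>
  first gives the diagonal entries of the operator, summing over \<open>E\<close> first gives
  Parseval's identity, and this value is free of \<open>E\<close>.\<close>

lemma bessel_multiplier_trace:
  assumes bessel: "bessel_seq K \<psi> B" "bessel_seq K \<phi> B'" and m: "m \<in> lp 1 K" and E: "is_onb E"
  shows "(\<lambda>k. m k * cinner (\<phi> k) (\<psi> k)) summable_on K"
    and "((\<lambda>e. cinner (bessel_multiplier K m \<phi> \<psi> e) e) has_sum (\<Sum>\<^sub>\<infinity>k\<in>K. m k * cinner (\<phi> k) (\<psi> k))) E"
proof -
  define f where "f = (\<lambda>(k, e). m k * (cinner (\<phi> k) e * cinner e (\<psi> k)))"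
  have sum_e: "(\<lambda>e. norm (f (k, e))) summable_on E" for k
    unfolding f_def using onb_abs_parseval(1)[OF E, of "\<phi> k" "\<psi> k"]
    by (simp add: norm_mult[of "m k"] summable_on_cmult_right)
  have bound: "norm (\<Sum>\<^sub>\<infinity>e\<in>E. norm (f (k, e))) \<le> sqrt B' * sqrt B * norm (m k)" if "k \<in> K" for k
  proof -
    have "(\<Sum>\<^sub>\<infinity>e\<in>E. norm (f (k, e))) = norm (m k) * (\<Sum>\<^sub>\<infinity>e\<in>E. norm (cinner (\<phi> k) e * cinner e (\<psi> k)))"
      by (simp add: f_def norm_mult[of "m k"] infsum_cmult_right')
    also have "\<dots> \<le> norm (m k) * (norm (\<phi> k) * norm (\<psi> k))"
      by (intro mult_left_mono onb_abs_parseval(2)[OF E]) simp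
    also have "\<dots> \<le> norm (m k) * (sqrt B' * sqrt B)"
      using bessel_seq_norm_le[OF bessel(1) that] bessel_seq_norm_le[OF bessel(2) that] bessel
      by (intro mult_left_mono mult_mono) (auto simp: bessel_seq_def)
    finally show ?thesis
      by (simp add: infsum_nonneg mult_ac)
  qed
  have "(\<lambda>p. norm (f p)) summable_on K \<times> E"
    unfolding Infinite_Sum.abs_summable_on_Sigma_iff
  proof (intro conjI ballI sum_e)
    have "(\<lambda>k. sqrt B' * sqrt B * norm (m k)) summable_on K"
      using m by (intro summable_on_cmult_right) (simp add: lp1_iff)
    then show "(\<lambda>k. norm (\<Sum>\<^sub>\<infinity>e\<in>E. norm (f (k, e)))) summable_on K"
      using bound by (rule Infinite_Sum.abs_summable_on_comparison_test')
  qed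
  then obtain S where S: "(f has_sum S) (K \<times> E)"
    using abs_summable_summable summable_on_def by blast
  have "((\<lambda>(e, k). f (k, e)) has_sum S) (E \<times> K)"
    using S has_sum_swap by blast
  then have E_sum: "((\<lambda>e. cinner (bessel_multiplier K m \<phi> \<psi> e) e) has_sum S) E"
  proof (rule has_sum_SigmaD)
    fix e
    show "((\<lambda>k. (\<lambda>(e, k). f (k, e)) (e, k)) has_sum cinner (bessel_multiplier K m \<phi> \<psi> e) e) K"
      using cinner_bessel_multiplier_has_sum[OF bessel lp1_linf[OF m], of e e]
      by (simp add: f_def mult_ac)
  qed
  have "((\<lambda>k. m k * cinner (\<phi> k) (\<psi> k)) has_sum S) K"
    by (rule has_sum_SigmaD[OF S]) (use has_sum_cmult_right[OF onb_parseval[OF E]] in \<open>simp add: f_def\<close>)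
  then show "(\<lambda>k. m k * cinner (\<phi> k) (\<psi> k)) summable_on K"
    and "((\<lambda>e. cinner (bessel_multiplier K m \<phi> \<psi> e) e) has_sum (\<Sum>\<^sub>\<infinity>k\<in>K. m k * cinner (\<phi> k) (\<psi> k))) E"
    using E_sum infsumI summable_on_def by blast+
qed

lemma trace_op_bessel_multiplier:
  fixes \<psi> \<phi> :: "'k \<Rightarrow> 'a::complex_hilbert_space"
  assumes "bessel_seq K \<psi> B" "bessel_seq K \<phi> B'" "m \<in> lp 1 K"
  shows "trace_op (bessel_multiplier K m \<phi> \<psi>) = (\<Sum>\<^sub>\<infinity>k\<in>K. m k * cinner (\<phi> k) (\<psi> k))"
  unfolding trace_op_def
proof (rule the_equality)
  show "\<forall>E. is_onb E \<longrightarrow> ((\<lambda>e. cinner (bessel_multiplier K m \<phi> \<psi> e) e) has_sum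
      (\<Sum>\<^sub>\<infinity>k\<in>K. m k * cinner (\<phi> k) (\<psi> k))) E"
    using bessel_multiplier_trace(2)[OF assms] by blast
  fix t assume t: "\<forall>E. is_onb E \<longrightarrow> ((\<lambda>e. cinner (bessel_multiplier K m \<phi> \<psi> e) e) has_sum t) E"
  obtain E :: "'a set" where E: "is_onb E"
    using ex_onb by blast
  show "t = (\<Sum>\<^sub>\<infinity>k\<in>K. m k * cinner (\<phi> k) (\<psi> k))"
    using t E bessel_multiplier_trace(2)[OF assms E] has_sum_unique by blast
qed

lemma has_sum_sum_finite:
  fixes f :: "'i \<Rightarrow> 'k \<Rightarrow> 'a::topological_comm_monoid_add"
  assumes "\<And>i. i \<in> F \<Longrightarrow> (f i has_sum S i) K"
  shows "((\<lambda>k. \<Sum>i\<in>F. f i k) has_sum (\<Sum>i\<in>F. S i)) K"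
  using assms by (induction F rule: infinite_finite_induct) (auto intro: has_sum_add)

text \<open>
  The vectors \<open>M e / norm (M e)\<close> are orthonormal, so that \<open>norm (M e) = cinner (M e) (f e)\<close> can be
  expanded along \<open>K\<close> and summed over \<open>e\<close> by Cauchy--Schwarz and Bessel's inequality in both spaces.
\<close>

lemma bessel_multiplier_eigenbasis_norm_sum_le:
  fixes \<phi> :: "'k \<Rightarrow> 'b::complex_hilbert_space" and \<psi> :: "'k \<Rightarrow> 'a::complex_hilbert_space"
  assumes bessel: "bessel_seq K \<psi> B" "bessel_seq K \<phi> B'" and m: "m \<in> lp 1 K"
    and F: "finite F" "orthonormal F"
    and ortho: "\<And>e e'. e \<in> F \<Longrightarrow> e' \<in> F \<Longrightarrow> e \<noteq> e' \<Longrightarrow>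
      cinner (bessel_multiplier K m \<phi> \<psi> e) (bessel_multiplier K m \<phi> \<psi> e') = 0"
  shows "(\<Sum>e\<in>F. norm (bessel_multiplier K m \<phi> \<psi> e)) \<le> sqrt B' * sqrt B * lp_norm 1 K m"
proof -
  define A where "A = bessel_multiplier K m \<phi> \<psi>"
  \<comment> \<open>If \<open>A e = 0\<close>, division by zero makes \<open>f e = 0\<close>; hence
    norm at most 1, and the pairing with \<open>A e\<close> needs no case distinction.\<close>
  define f where "f e = (1 / norm (A e)) *\<^sub>R A e" for e
  have norm_f: "norm (f e) \<le> 1" for e
    by (simp add: f_def)
  have ortho_f: "cinner (f e) (f e') = 0" if "e \<in> F" "e' \<in> F" "e \<noteq> e'" for e e'
    using ortho[OF that] by (simp add: f_def A_def scaleR_scaleC cinner_scaleC_left cinner_scaleC_right)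
  have A_f: "cinner (A e) (f e) = complex_of_real (norm (A e))" for e
    by (simp add: f_def scaleR_scaleC cinner_scaleC_right cinner_self power2_eq_square)
  have "((\<lambda>k. \<Sum>e\<in>F. m k * cinner e (\<psi> k) * cinner (\<phi> k) (f e)) has_sum (\<Sum>e\<in>F. cinner (A e) (f e))) K"
    unfolding A_def by (intro has_sum_sum_finite cinner_bessel_multiplier_has_sum[OF bessel lp1_linf[OF m]])
  moreover have "((\<lambda>k. sqrt B' * sqrt B * norm (m k)) has_sum (sqrt B' * sqrt B * lp_norm 1 K m)) K"
    using m unfolding lp_norm_1 lp1_iff by (intro has_sum_cmult_right) simp
  ultimately have "norm (\<Sum>e\<in>F. cinner (A e) (f e)) \<le> sqrt B' * sqrt B * lp_norm 1 K m"
  proof (rule norm_infsum_le)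
    fix k assume k: "k \<in> K"
    have "norm (\<Sum>e\<in>F. m k * cinner e (\<psi> k) * cinner (\<phi> k) (f e))
        \<le> (\<Sum>e\<in>F. norm (m k) * (\<bar>norm (cinner (\<psi> k) e)\<bar> * \<bar>norm (cinner (\<phi> k) (f e))\<bar>))"
      by (rule sum_norm_le) (simp add: norm_mult norm_cinner_commute[of "\<psi> k"])
    also have "\<dots> = norm (m k) * (\<Sum>e\<in>F. \<bar>norm (cinner (\<psi> k) e)\<bar> * \<bar>norm (cinner (\<phi> k) (f e))\<bar>)"
      by (rule sum_distrib_left[symmetric])
    also have "\<dots> \<le> norm (m k) * (L2_set (\<lambda>e. norm (cinner (\<psi> k) e)) F * L2_set (\<lambda>e. norm (cinner (\<phi> k) (f e))) F)"
      by (intro mult_left_mono L2_set_mult_ineq) simp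
    also have "\<dots> \<le> norm (m k) * (norm (\<psi> k) * norm (\<phi> k))"
      using bessel_inequality_finite[OF F(1) norm_f ortho_f] orthonormal_L2_set_le[OF F(2,1)]
      by (intro mult_left_mono mult_mono) auto
    also have "\<dots> \<le> norm (m k) * (sqrt B * sqrt B')"
      using bessel_seq_norm_le[OF bessel(1) k] bessel_seq_norm_le[OF bessel(2) k] bessel
      by (intro mult_left_mono mult_mono) (auto simp: bessel_seq_def)
    finally show "norm (\<Sum>e\<in>F. m k * cinner e (\<psi> k) * cinner (\<phi> k) (f e)) \<le> sqrt B' * sqrt B * norm (m k)"
      by (simp add: mult_ac)
  qed
  moreover have "norm (\<Sum>e\<in>F. cinner (A e) (f e)) = (\<Sum>e\<in>F. norm (A e))"
    unfolding A_f of_real_sum[symmetric] norm_of_real by (simp add: sum_nonneg)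
  ultimately show ?thesis
    by (simp add: A_def)
qed

text \<open>Finite partial sums of \<open>norm (?M e)\<close> are bounded before any summability is
  known. The one bound then puts the symbol of the absolute value into \<open>lp 1 E\<close>, which
  opens the trace formula, and also estimates the resulting trace.\<close>

lemma trace_class_bessel_multiplier:
  fixes \<phi> :: "'k \<Rightarrow> 'b::complex_hilbert_space" and \<psi> :: "'k \<Rightarrow> 'a::complex_hilbert_space"
  assumes bessel: "bessel_seq K \<psi> B" "bessel_seq K \<phi> B'" and m: "m \<in> lp 1 K"
  shows "trace_class (bessel_multiplier K m \<phi> \<psi>)" (is "trace_class ?M")
    and "trace_norm (bessel_multiplier K m \<phi> \<psi>) \<le> sqrt B' * sqrt B * lp_norm 1 K m"
proof -
  note linf = lp1_linf[OF m]
  define M' where "M' = bessel_multiplier K (\<lambda>k. cnj (m k)) \<psi> \<phi>"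
  have clM: "bounded_clinear ?M" and clM': "bounded_clinear M'"
    unfolding M'_def using bounded_clinear_bessel_multiplier bessel linf linf_cnj by blast+
  have adj: "cinner (?M x) y = cinner x (M' y)" for x y
    unfolding M'_def by (rule cinner_bessel_multiplier[OF bessel linf])
  have "compact_op ?M"
    using m by (intro compact_op_bessel_multiplier[OF bessel] lp_subset_c0[of m 1]) auto
  then obtain E where E: "is_onb E" "\<And>e. e \<in> E \<Longrightarrow> M' (?M e) = complex_of_real ((norm (?M e))\<^sup>2) *\<^sub>C e"
    using compact_op_eigenbasis[OF _ clM' adj] by blast
  note on = is_onb_orthonormal[OF E(1)]
  note besselE = bessel_seq_orthonormal[OF on]
  have abs_eq: "abs_op ?M = bessel_multiplier E (\<lambda>e. complex_of_real (norm (?M e))) (\<lambda>e. e) (\<lambda>e. e)"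
    by (rule abs_op_eigenbasis[OF clM clM' adj E])
  \<comment> \<open>The adjoint moves \<open>?M\<close> across, and \<open>e'\<close> is an
    eigenvector, leaving a multiple of \<open>cinner e e'\<close>.\<close>
  have "cinner (?M e) (?M e') = 0" if "e \<in> E" "e' \<in> E" "e \<noteq> e'" for e e'
    using that on by (simp add: adj E(2) cinner_scaleC_right orthonormal_def)
  then have le: "(\<Sum>e\<in>F. norm (?M e)) \<le> sqrt B' * sqrt B * lp_norm 1 K m" if "finite F" "F \<subseteq> E" for F
    using that orthonormal_subset[OF on] by (intro bessel_multiplier_eigenbasis_norm_sum_le[OF bessel m]) blast+
  have summ: "(\<lambda>e. norm (?M e)) summable_on E"
    by (rule nonneg_bdd_above_summable_on) (use le in \<open>auto simp: bdd_above_def\<close>)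
  then have lp1: "(\<lambda>e. complex_of_real (norm (?M e))) \<in> lp 1 E"
    by (simp add: lp1_iff)
  have "(\<lambda>e. cinner (abs_op ?M e) e) summable_on E"
    unfolding abs_eq by (rule has_sum_imp_summable[OF bessel_multiplier_trace(2)[OF besselE besselE lp1 E(1)]])
  then show "trace_class ?M"
    using clM E(1) by (auto simp: trace_class_def)
  have "trace_op (abs_op ?M) = (\<Sum>\<^sub>\<infinity>e\<in>E. complex_of_real (norm (?M e)) * cinner e e)"
    unfolding abs_eq by (rule trace_op_bessel_multiplier[OF besselE besselE lp1])
  also have "\<dots> = (\<Sum>\<^sub>\<infinity>e\<in>E. complex_of_real (norm (?M e)))"
    by (rule infsum_cong) (use on in \<open>simp add: orthonormal_def cinner_self\<close>)
  also have "\<dots> = complex_of_real (\<Sum>\<^sub>\<infinity>e\<in>E. norm (?M e))"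
    using summ by (intro infsumI has_sum_of_real) simp
  finally have "trace_norm ?M = (\<Sum>\<^sub>\<infinity>e\<in>E. norm (?M e))"
    by (simp add: trace_norm_def)
  also have "\<dots> \<le> sqrt B' * sqrt B * lp_norm 1 K m"
    using summ le by (rule infsum_le_finite_sums)
  finally show "trace_norm ?M \<le> sqrt B' * sqrt B * lp_norm 1 K m" .
qed

section \<open>Square-summable symbols\<close>

text \<open>Sum the squared matrix entries by rows and by columns. The resulting value mentions
  \<open>G\<close> only, so with \<open>G\<close> fixed it is the same for every basis
  \<open>E\<close>.\<close>

lemma onb_norm_sum_adjoint:
  assumes adj: "\<And>x y. cinner (M x) y = cinner x (M' y)"
    and E: "is_onb E" and G: "is_onb G" and summ: "(\<lambda>e. (norm (M e))\<^sup>2) summable_on E"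
  shows "((\<lambda>e. (norm (M e))\<^sup>2) has_sum (\<Sum>\<^sub>\<infinity>g\<in>G. (norm (M' g))\<^sup>2)) E"
proof -
  define h where "h = (\<lambda>(e, g). (norm (cinner (M e) g))\<^sup>2)"
  have rows: "((\<lambda>g. h (e, g)) has_sum (norm (M e))\<^sup>2) G" for e
    using onb_parseval_norm[OF G] by (simp add: h_def)
  have "h summable_on E \<times> G"
    by (rule summable_on_SigmaI[OF rows summ]) (auto simp: h_def)
  then obtain S where S: "(h has_sum S) (E \<times> G)"
    by (auto simp: summable_on_def)
  have "((\<lambda>e. (norm (M e))\<^sup>2) has_sum S) E"
    by (rule has_sum_SigmaD[OF S rows])
  moreover have "((\<lambda>g. (norm (M' g))\<^sup>2) has_sum S) G"
  proof (rule has_sum_SigmaD)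
    show "((\<lambda>(g, e). h (e, g)) has_sum S) (G \<times> E)"
      using S has_sum_swap by blast
    show "((\<lambda>e. (\<lambda>(g, e). h (e, g)) (g, e)) has_sum (norm (M' g))\<^sup>2) E" for g
      using onb_parseval_norm[OF E, of "M' g"] by (simp add: h_def adj norm_cinner_commute)
  qed
  ultimately show ?thesis
    using infsumI by blast
qed

text \<open>\<open>B'\<close> comes from the synthesis bound at each \<open>e\<close>. After the
  finite sum over \<open>e\<close> is moved inside the series over \<open>k\<close>, Bessel's
  inequality along \<open>F\<close> bounds the inner sum by the squared norm of \<psi> k, hence by
  \<open>B\<close>.\<close>

lemma bessel_multiplier_hs_sum_le:
  assumes bessel: "bessel_seq K \<psi> B" "bessel_seq K \<phi> B'" and m: "(\<lambda>k. (norm (m k))\<^sup>2) summable_on K"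
    and linf: "m \<in> linf K" and F: "finite F" "orthonormal F"
  shows "(\<Sum>e\<in>F. (norm (bessel_multiplier K m \<phi> \<psi> e))\<^sup>2) \<le> B' * (B * (\<Sum>\<^sub>\<infinity>k\<in>K. (norm (m k))\<^sup>2))"
proof -
  have B: "B > 0" "B' > 0"
    using bessel by (auto simp: bessel_seq_def)
  let ?c = "\<lambda>e k. (norm (m k * cinner e (\<psi> k)))\<^sup>2"
  have c: "?c e summable_on K" for e
    by (rule multiplier_coeff_summable(1)[OF bessel(1) norm_le_linf_norm[OF linf]])
  have "(norm (bessel_multiplier K m \<phi> \<psi> e))\<^sup>2 \<le> B' * infsum (?c e) K" for e
  proof -
    have "(norm (bessel_multiplier K m \<phi> \<psi> e))\<^sup>2 \<le> (sqrt (B' * infsum (?c e) K))\<^sup>2"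
      unfolding bessel_multiplier_def by (intro power_mono bessel_synthesis_norm_le[OF bessel(2) c]) simp
    then show ?thesis
      using B by (simp add: infsum_nonneg)
  qed
  then have "(\<Sum>e\<in>F. (norm (bessel_multiplier K m \<phi> \<psi> e))\<^sup>2) \<le> (\<Sum>e\<in>F. B' * infsum (?c e) K)"
    by (intro sum_mono)
  also have "\<dots> = B' * (\<Sum>e\<in>F. infsum (?c e) K)"
    by (simp add: sum_distrib_left)
  also have "(\<Sum>e\<in>F. infsum (?c e) K) \<le> B * (\<Sum>\<^sub>\<infinity>k\<in>K. (norm (m k))\<^sup>2)"
  proof (rule has_sum_mono)
    show "((\<lambda>k. \<Sum>e\<in>F. ?c e k) has_sum (\<Sum>e\<in>F. infsum (?c e) K)) K"
      using c by (intro has_sum_sum_finite) simp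
    show "((\<lambda>k. B * (norm (m k))\<^sup>2) has_sum (B * (\<Sum>\<^sub>\<infinity>k\<in>K. (norm (m k))\<^sup>2))) K"
      using m by (intro has_sum_cmult_right) simp
    fix k assume k: "k \<in> K"
    have "(\<Sum>e\<in>F. ?c e k) = (norm (m k))\<^sup>2 * (L2_set (\<lambda>e. norm (cinner (\<psi> k) e)) F)\<^sup>2"
      by (simp add: L2_set_def sum_nonneg norm_mult power_mult_distrib sum_distrib_left norm_cinner_commute[of "\<psi> k"])
    also have "\<dots> \<le> (norm (m k))\<^sup>2 * (sqrt B)\<^sup>2"
      using order.trans[OF orthonormal_L2_set_le[OF F(2,1)] bessel_seq_norm_le[OF bessel(1) k]]
      by (intro mult_left_mono power_mono) auto
    finally show "(\<Sum>e\<in>F. ?c e k) \<le> B * (norm (m k))\<^sup>2"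
      using B by (simp add: mult_ac)
  qed
  finally show ?thesis
    using B by simp
qed

lemma hilbert_schmidt_bessel_multiplier:
  fixes \<phi> :: "'k \<Rightarrow> 'b::complex_hilbert_space" and \<psi> :: "'k \<Rightarrow> 'a::complex_hilbert_space"
  assumes bessel: "bessel_seq K \<psi> B" "bessel_seq K \<phi> B'" and m: "m \<in> lp 2 K"
  shows "hilbert_schmidt (bessel_multiplier K m \<phi> \<psi>)" (is "hilbert_schmidt ?M")
    and "hilbert_schmidt_norm (bessel_multiplier K m \<phi> \<psi>) \<le> sqrt B' * sqrt B * lp_norm 2 K m"
proof -
  have linf: "m \<in> linf K"
    using m by (intro c0_subset_linf lp_subset_c0[of m 2]) auto
  have summ_m: "(\<lambda>k. (norm (m k))\<^sup>2) summable_on K"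
    using m by (simp add: lp_def)
  let ?C = "B' * (B * (\<Sum>\<^sub>\<infinity>k\<in>K. (norm (m k))\<^sup>2))"
  have le: "(\<Sum>e\<in>F. (norm (?M e))\<^sup>2) \<le> ?C" if "is_onb E" "finite F" "F \<subseteq> E" for E F
    using that by (intro bessel_multiplier_hs_sum_le[OF bessel summ_m linf])
      (auto intro: orthonormal_subset is_onb_orthonormal)
  have summ: "(\<lambda>e. (norm (?M e))\<^sup>2) summable_on E" if "is_onb E" for E
    by (rule nonneg_bdd_above_summable_on) (use le[OF that] in \<open>auto simp: bdd_above_def\<close>)
  obtain E :: "'a set" where E: "is_onb E"
    using ex_onb by blast
  obtain G :: "'b set" where G: "is_onb G"
    using ex_onb by blast
  show "hilbert_schmidt ?M"
    using summ[OF E] E bounded_clinear_bessel_multiplier[OF bessel linf] by (auto simp: hilbert_schmidt_def)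
  define S where "S = (\<Sum>\<^sub>\<infinity>g\<in>G. (norm (bessel_multiplier K (\<lambda>k. cnj (m k)) \<psi> \<phi> g))\<^sup>2)"
  have S: "((\<lambda>e. (norm (?M e))\<^sup>2) has_sum S) E" if "is_onb E" for E
    unfolding S_def
    by (rule onb_norm_sum_adjoint[OF cinner_bessel_multiplier[OF bessel linf] that G summ[OF that]])
  have "(THE s. \<forall>E. is_onb E \<longrightarrow> ((\<lambda>e. (norm (?M e))\<^sup>2) has_sum s) E) = S"
    using S E has_sum_unique by (intro the_equality) blast+
  then have "hilbert_schmidt_norm ?M = sqrt S"
    by (simp add: hilbert_schmidt_norm_def)
  also have "\<dots> \<le> sqrt ?C"
    using has_sum_le_finite_sums[OF S[OF E]] le[OF E] by simp
  also have "\<dots> = sqrt B' * sqrt B * lp_norm 2 K m"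
    by (simp add: lp_norm_def real_sqrt_mult powr_half_sqrt infsum_nonneg)
  finally show "hilbert_schmidt_norm ?M \<le> sqrt B' * sqrt B * lp_norm 2 K m" .
qed

text \<open>The trace needs equal domain and codomain, whereas \<phi> lives in \<open>'b\<close>;
  its formula therefore ranges over an arbitrary Bessel sequence \<eta> in \<open>'a\<close>.
  Stating it with \<open>has_sum\<close> includes convergence of the series.\<close>

theorem theorem6p1:
  fixes K :: "'k set"
    and \<psi> :: "'k \<Rightarrow> 'a::complex_hilbert_space"
    and \<phi> :: "'k \<Rightarrow> 'b::complex_hilbert_space"
    and m :: "'k \<Rightarrow> complex"
    and B B' :: real
  assumes "countable K"
    and "separable_space (euclidean :: 'a topology)"
    and "separable_space (euclidean :: 'b topology)"
    and "bessel_seq K \<psi> B"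
    and "bessel_seq K \<phi> B'"
  shows
    "(m \<in> linf K \<longrightarrow>
        (\<forall>f. (\<lambda>k. (m k * cinner f (\<psi> k)) *\<^sub>C \<phi> k) summable_on K) \<and>
        bounded_clinear (bessel_multiplier K m \<phi> \<psi>) \<and>
        onorm (bessel_multiplier K m \<phi> \<psi>) \<le> sqrt B' * sqrt B * linf_norm K m) \<and>
     (m \<in> linf K \<longrightarrow>
        cadjoint (bessel_multiplier K m \<phi> \<psi>) = bessel_multiplier K (\<lambda>k. cnj (m k)) \<psi> \<phi> \<and>
        ((\<forall>k\<in>K. m k \<in> \<real>) \<longrightarrow> self_adjoint_op (bessel_multiplier K m \<psi> \<psi>))) \<and>
     (m \<in> c0 K \<longrightarrow> compact_op (bessel_multiplier K m \<phi> \<psi>)) \<and>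
     (m \<in> lp 1 K \<longrightarrow>
        trace_class (bessel_multiplier K m \<phi> \<psi>) \<and>
        trace_norm (bessel_multiplier K m \<phi> \<psi>) \<le> sqrt B' * sqrt B * lp_norm 1 K m \<and>
        (\<forall>(\<eta> :: 'k \<Rightarrow> 'a) B''. bessel_seq K \<eta> B'' \<longrightarrow>
           ((\<lambda>k. m k * cinner (\<eta> k) (\<psi> k)) has_sum trace_op (bessel_multiplier K m \<eta> \<psi>)) K)) \<and>
     (m \<in> lp 2 K \<longrightarrow>
        hilbert_schmidt (bessel_multiplier K m \<phi> \<psi>) \<and>
        hilbert_schmidt_norm (bessel_multiplier K m \<phi> \<psi>) \<le> sqrt B' * sqrt B * lp_norm 2 K m)"
proof (intro conjI impI allI)
  note bessel = assms(4,5)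
  let ?M = "bessel_multiplier K m \<phi> \<psi>"
  {
    assume m: "m \<in> linf K"
    show "(\<lambda>k. (m k * cinner f (\<psi> k)) *\<^sub>C \<phi> k) summable_on K" for f
      by (rule has_sum_imp_summable[OF bessel_multiplier_has_sum[OF bessel m]])
    show "bounded_clinear ?M"
      by (rule bounded_clinear_bessel_multiplier[OF bessel m])
    show "onorm ?M \<le> sqrt B' * sqrt B * linf_norm K m"
      by (rule onorm_bessel_multiplier_le[OF bessel m])
    show "cadjoint ?M = bessel_multiplier K (\<lambda>k. cnj (m k)) \<psi> \<phi>"
      by (rule cadjoint_bessel_multiplier[OF bessel m])
    show "self_adjoint_op (bessel_multiplier K m \<psi> \<psi>)" if "\<forall>k\<in>K. m k \<in> \<real>"
      using that by (intro self_adjoint_bessel_multiplier[OF bessel(1) m]) blast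
  next
    assume m: "m \<in> c0 K"
    show "compact_op ?M"
      by (rule compact_op_bessel_multiplier[OF bessel m])
  next
    assume m: "m \<in> lp 1 K"
    show "trace_class ?M" "trace_norm ?M \<le> sqrt B' * sqrt B * lp_norm 1 K m"
      by (rule trace_class_bessel_multiplier[OF bessel m])+
    show "((\<lambda>k. m k * cinner (\<eta> k) (\<psi> k)) has_sum trace_op (bessel_multiplier K m \<eta> \<psi>)) K"
      if \<eta>: "bessel_seq K \<eta> B''" for \<eta> B''
    proof -
      \<comment> \<open>Summability over \<open>K\<close> was obtained from the double sum with a
        basis, so one is chosen although the claim mentions none.\<close>
      obtain E :: "'a set" where "is_onb E"
        using ex_onb by blast
      then show ?thesis
        unfolding trace_op_bessel_multiplier[OF bessel(1) \<eta> m]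
        using bessel_multiplier_trace(1)[OF bessel(1) \<eta> m] by simp
    qed
  next
    assume m: "m \<in> lp 2 K"
    show "hilbert_schmidt ?M" "hilbert_schmidt_norm ?M \<le> sqrt B' * sqrt B * lp_norm 2 K m"
      by (rule hilbert_schmidt_bessel_multiplier[OF bessel m])+
  }
qed

end
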